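(* Let $(G_n)_{n\ge1}$ be a sequence of uniformly locally finite simple undirected graphs, and for each $n$ let $v^{(n)}$ be a vertex of $G_n$. Let $G$ be a uniformly locally finite simple undirected graph and $v\in G$. Suppose that for every $d\in\mathbb{N}$ there exists $N(d)$ such that for all $n\ge N(d)$ the ball of radius $d$ around $v^{(n)}$ in $G_n$ is isomorphic to the ball of radius $d$ around $v$ in $G$, via an isomorphism sending $v^{(n)}$ to $v$. Then $\mathcal{E}_{G_n}(v^{(n)})\to\mathcal{E}_G(v)$ as $n\to\infty$.
   Context: A graph $G=(V,E)$ (countable vertex set) is uniformly locally finite if $\sup_{v\in V}\deg(v)<\infty$. Its adjacency operator $A$ on $\ell^2(V)$ is defined by $A\delta_x=\sum_{x'\sim x}\delta_{x'}$, where $\{\delta_x\}$ is the standard orthonormal basis; it is bounded and self-adjoint. Let $|A|=(AA^* )^{1/2}$; the energy of a vertex $v$ is $\mathcal{E}_G(v)=\langle|A|\delta_v,\delta_v\rangle$. The ball of radius $d$ around $v$ is the subgraph induced by the vertices at graph distance at most $d$ from $v$. *)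

theory Defs
  imports "HOL-Analysis.Analysis"
begin

record 'a ugraph =
  verts :: "'a set"
  edges :: "'a set set"

definition simple_graph :: "'a ugraph \<Rightarrow> bool" where
  "simple_graph G \<longleftrightarrow> countable (verts G) \<and> (\<forall>e\<in>edges G. e \<subseteq> verts G \<and> card e = 2)"

definition adj :: "'a ugraph \<Rightarrow> 'a \<Rightarrow> 'a \<Rightarrow> bool" where
  "adj G x y \<longleftrightarrow> {x, y} \<in> edges G"

definition neighbours :: "'a ugraph \<Rightarrow> 'a \<Rightarrow> 'a set" where
  "neighbours G x = {y. adj G x y}"

(* Finiteness is required separately because the cardinality of an infinite set is 0. *)
definition uniformly_locally_finite :: "'a ugraph \<Rightarrow> bool" where
  "uniformly_locally_finite G \<longleftrightarrow>
     (\<exists>D. \<forall>x\<in>verts G. finite (neighbours G x) \<and> card (neighbours G x) \<le> D)"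

(* The relational power says that there is a walk of length k from x to y;
   vertices in different components are at distance infinity. *)
definition graph_dist :: "'a ugraph \<Rightarrow> 'a \<Rightarrow> 'a \<Rightarrow> enat" where
  "graph_dist G x y = (INF k \<in> {k. (adj G ^^ k) x y}. enat k)"

definition induced_subgraph :: "'a ugraph \<Rightarrow> 'a set \<Rightarrow> 'a ugraph" where
  "induced_subgraph G S = \<lparr>verts = S, edges = {e \<in> edges G. e \<subseteq> S}\<rparr>"

definition graph_ball :: "'a ugraph \<Rightarrow> 'a \<Rightarrow> nat \<Rightarrow> 'a ugraph" where
  "graph_ball G v d = induced_subgraph G {x \<in> verts G. graph_dist G v x \<le> enat d}"

definition graph_iso :: "('a \<Rightarrow> 'b) \<Rightarrow> 'a ugraph \<Rightarrow> 'b ugraph \<Rightarrow> bool" where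
  "graph_iso \<phi> G H \<longleftrightarrow>
     bij_betw \<phi> (verts G) (verts H) \<and>
     (\<forall>x\<in>verts G. \<forall>y\<in>verts G. adj G x y \<longleftrightarrow> adj H (\<phi> x) (\<phi> y))"

definition rooted_isomorphic :: "'a ugraph \<Rightarrow> 'a \<Rightarrow> 'b ugraph \<Rightarrow> 'b \<Rightarrow> bool" where
  "rooted_isomorphic G v H w \<longleftrightarrow> (\<exists>\<phi>. graph_iso \<phi> G H \<and> \<phi> v = w)"


(* The complex Hilbert space of square-summable functions on V. Its elements are represented
   by functions on the whole ambient type that vanish outside V. *)
definition ell2 :: "'a set \<Rightarrow> ('a \<Rightarrow> complex) set" where
  "ell2 V = {f. (\<forall>x. x \<notin> V \<longrightarrow> f x = 0) \<and> (\<lambda>x. (cmod (f x))\<^sup>2) summable_on V}"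

definition l2_inner :: "'a set \<Rightarrow> ('a \<Rightarrow> complex) \<Rightarrow> ('a \<Rightarrow> complex) \<Rightarrow> complex" where
  "l2_inner V f g = (\<Sum>\<^sub>\<infinity>x\<in>V. f x * cnj (g x))"

definition l2_norm :: "'a set \<Rightarrow> ('a \<Rightarrow> complex) \<Rightarrow> real" where
  "l2_norm V f = sqrt (\<Sum>\<^sub>\<infinity>x\<in>V. (cmod (f x))\<^sup>2)"

definition delta :: "'a \<Rightarrow> 'a \<Rightarrow> complex" where
  "delta x = (\<lambda>y. if y = x then 1 else 0)"

type_synonym 'a operator = "('a \<Rightarrow> complex) \<Rightarrow> ('a \<Rightarrow> complex)"

(* Membership in the extensional function space fixes the value of T outside ell2 V, so that
   operators agreeing on ell2 V are equal and the definite descriptions below make sense. *)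
definition bounded_operator :: "'a set \<Rightarrow> 'a operator \<Rightarrow> bool" where
  "bounded_operator V T \<longleftrightarrow>
     T \<in> ell2 V \<rightarrow>\<^sub>E ell2 V \<and>
     (\<forall>f\<in>ell2 V. \<forall>g\<in>ell2 V. T (\<lambda>x. f x + g x) = (\<lambda>x. T f x + T g x)) \<and>
     (\<forall>c. \<forall>f\<in>ell2 V. T (\<lambda>x. c * f x) = (\<lambda>x. c * T f x)) \<and>
     (\<exists>C. \<forall>f\<in>ell2 V. l2_norm V (T f) \<le> C * l2_norm V f)"

definition adjoint_operator :: "'a set \<Rightarrow> 'a operator \<Rightarrow> 'a operator" where
  "adjoint_operator V T =
     (THE S. bounded_operator V S \<and>
        (\<forall>f\<in>ell2 V. \<forall>g\<in>ell2 V. l2_inner V (T f) g = l2_inner V f (S g)))"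

(* Over the complex numbers, real nonnegative values of the quadratic form already force
   self-adjointness. *)
definition positive_operator :: "'a set \<Rightarrow> 'a operator \<Rightarrow> bool" where
  "positive_operator V T \<longleftrightarrow>
     bounded_operator V T \<and> (\<forall>f\<in>ell2 V. l2_inner V (T f) f \<in> \<real>\<^sub>\<ge>\<^sub>0)"

definition sqrt_operator :: "'a set \<Rightarrow> 'a operator \<Rightarrow> 'a operator" where
  "sqrt_operator V T = (THE S. positive_operator V S \<and> compose (ell2 V) S S = T)"

definition abs_operator :: "'a set \<Rightarrow> 'a operator \<Rightarrow> 'a operator" where
  "abs_operator V T = sqrt_operator V (compose (ell2 V) T (adjoint_operator V T))"

(* A bounded operator is determined by its values on the orthonormal basis; one with the
   prescribed values exists when G is uniformly locally finite. *)
definition adjacency_operator :: "'a ugraph \<Rightarrow> 'a operator" where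
  "adjacency_operator G =
     (THE T. bounded_operator (verts G) T \<and>
        (\<forall>x\<in>verts G. T (delta x) = (\<lambda>y. \<Sum>x'\<in>neighbours G x. delta x' y)))"

(* The value is a nonnegative real, kept as a complex number. *)
definition energy :: "'a ugraph \<Rightarrow> 'a \<Rightarrow> complex" where
  "energy G v =
     l2_inner (verts G) (abs_operator (verts G) (adjacency_operator G) (delta v)) (delta v)"

end

theory Submission
  imports Defs "HOL-Computational_Algebra.Polynomial"
begin

text \<open>
  The degrees of the approximating graphs need not be bounded in \<open>n\<close>, so no polynomial approximates
  \<open>|x|\<close> on all spectra at once. Instead, let \<open>A\<close> be symmetric, \<open>P = |A|\<close> and \<open>Q = s(A)\<^sup>2\<close> for a real
  polynomial \<open>s\<close>. Then \<open>u = P \<delta> - Q \<delta>\<close> satisfies \<open>(P + Q) u = (A\<^sup>2 - Q\<^sup>2) \<delta>\<close>, and the Cauchy-Schwarz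
  inequality for the positive forms of \<open>P\<close> and \<open>Q\<close> gives
  \<open>\<parallel>u\<parallel>\<^sup>3 \<le> 2 \<parallel>(A\<^sup>2 - Q\<^sup>2) \<delta>\<parallel> (\<langle>P \<delta>, \<delta>\<rangle> + \<langle>Q \<delta>, \<delta>\<rangle>)\<close>. The right-hand side is controlled by finitely many
  moments \<open>\<langle>A\<^sup>k \<delta>, \<delta>\<rangle>\<close>, irrespective of the norm of \<open>A\<close>. It suffices to choose \<open>s\<close> for the limit graph,
  as an approximation of \<open>|x|\<^sup>1\<^sup>/\<^sup>2\<close> on its spectrum: the moments at the root depend only on a ball, so
  they agree eventually. With \<open>A\<^sup>2 = Q\<^sup>2\<close> the same inequality yields uniqueness of the square root.
\<close>

section \<open>Polynomials of an operator and square roots\<close>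

text \<open>Horner's scheme for \<open>p(F) x\<close> with the vector kept inside, so that induction
  on \<open>pCons\<close> peels off one coefficient and one application of \<open>F\<close> at a
  time.\<close>

definition opoly :: "real poly \<Rightarrow> ('h::real_vector \<Rightarrow> 'h) \<Rightarrow> 'h \<Rightarrow> 'h" where
  "opoly p F x = fold_coeffs (\<lambda>a y. a *\<^sub>R x + F y) p 0"

lemma opoly_0 [simp]: "opoly 0 F x = 0"
  by (simp add: opoly_def)

lemma opoly_pCons:
  assumes "linear F"
  shows "opoly (pCons a p) F x = a *\<^sub>R x + F (opoly p F x)"
  by (cases "a = 0 \<and> p = 0") (auto simp: opoly_def linear_0[OF assms])

lemma opoly_add:
  assumes "linear F"
  shows "opoly (p + q) F x = opoly p F x + opoly q F x"
  by (induction p q rule: poly_induct2)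
     (simp_all add: opoly_pCons[OF assms] linear_add[OF assms] algebra_simps)

lemma opoly_smult:
  assumes "linear F"
  shows "opoly (smult c p) F x = c *\<^sub>R opoly p F x"
  by (induction p) (simp_all add: opoly_pCons[OF assms] linear_scale[OF assms] scaleR_add_right)

lemma opoly_diff:
  assumes "linear F"
  shows "opoly (p - q) F x = opoly p F x - opoly q F x"
  using opoly_add[OF assms, of p "smult (- 1) q" x]
  by (simp only: opoly_smult[OF assms]) simp

lemma opoly_mult:
  assumes "linear F"
  shows "opoly (p * q) F x = opoly p F (opoly q F x)"
  by (induction p) (simp_all add: opoly_pCons[OF assms] opoly_add[OF assms] opoly_smult[OF assms]
      mult_pCons_left)

lemma linear_opoly:
  assumes "linear F"
  shows "linear (opoly p F)"
proof (rule linearI)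
  show "opoly p F (x + y) = opoly p F x + opoly p F y" for x y
    by (induction p) (simp_all add: opoly_pCons[OF assms] linear_add[OF assms] algebra_simps)
  show "opoly p F (c *\<^sub>R x) = c *\<^sub>R opoly p F x" for c x
    by (induction p) (simp_all add: opoly_pCons[OF assms] linear_scale[OF assms] algebra_simps)
qed

text \<open>Lets the nested iterations in \<open>modulus_approx\<close> collapse to a single
  polynomial in the original operator.\<close>

lemma opoly_pcompose:
  assumes "linear F"
  shows "opoly (pcompose p q) F x = opoly p (opoly q F) x"
  by (induction p) (simp_all add: pcompose_pCons opoly_pCons[OF assms] opoly_add[OF assms]
      opoly_mult[OF assms] opoly_pCons[OF linear_opoly[OF assms]] linear_0[OF assms])

lemma opoly_commute:
  assumes "linear F" "linear C" "\<And>x. C (F x) = F (C x)"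
  shows "C (opoly p F x) = opoly p F (C x)"
  by (induction p) (simp_all add: opoly_pCons[OF assms(1)] linear_0[OF assms(2)]
      linear_add[OF assms(2)] linear_scale[OF assms(2)] assms(3))

definition symmetric_op :: "('h::real_inner \<Rightarrow> 'h) \<Rightarrow> bool" where
  "symmetric_op F \<longleftrightarrow> (\<forall>x y. F x \<bullet> y = x \<bullet> F y)"

lemma symmetric_opD: "symmetric_op F \<Longrightarrow> F x \<bullet> y = x \<bullet> F y"
  by (simp add: symmetric_op_def)

lemma symmetric_opoly:
  assumes "linear F" "symmetric_op F"
  shows "symmetric_op (opoly p F)"
proof -
  have "opoly p F x \<bullet> y = x \<bullet> opoly p F y" for x y
  proof (induction p arbitrary: x y)
    case (pCons a p)
    have "F (opoly p F x) \<bullet> y = x \<bullet> opoly p F (F y)"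
      using pCons by (simp add: symmetric_opD[OF assms(2)])
    also have "opoly p F (F y) = F (opoly p F y)"
      by (rule opoly_commute[symmetric]) (use assms in auto)
    finally show ?case
      by (simp add: opoly_pCons[OF assms(1)] inner_add_left inner_add_right)
  qed auto
  then show ?thesis by (simp add: symmetric_op_def)
qed

section \<open>Nonnegative coefficients and norm bounds for contractions\<close>

definition nonneg_coeffs :: "real poly \<Rightarrow> bool" where
  "nonneg_coeffs p \<longleftrightarrow> (\<forall>i. 0 \<le> coeff p i)"

lemma nonneg_coeffs_add: "nonneg_coeffs p \<Longrightarrow> nonneg_coeffs q \<Longrightarrow> nonneg_coeffs (p + q)"
  by (simp add: nonneg_coeffs_def)

lemma nonneg_coeffs_mult: "nonneg_coeffs p \<Longrightarrow> nonneg_coeffs q \<Longrightarrow> nonneg_coeffs (p * q)"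
  by (auto simp: nonneg_coeffs_def coeff_mult intro!: sum_nonneg)

lemma nonneg_coeffs_smult: "0 \<le> c \<Longrightarrow> nonneg_coeffs p \<Longrightarrow> nonneg_coeffs (smult c p)"
  by (simp add: nonneg_coeffs_def)

text \<open>Powers of a contraction are contractions, so the triangle inequality leaves the sum of
  the coefficients, which is the value at 1.\<close>

lemma norm_opoly_le:
  fixes F :: "'h::real_normed_vector \<Rightarrow> 'h"
  assumes "linear F" "\<And>x. norm (F x) \<le> norm x" "nonneg_coeffs p"
  shows "norm (opoly p F x) \<le> poly p 1 * norm x"
  using assms(3)
proof (induction p)
  case (pCons a p)
  have a: "0 \<le> a" and p: "nonneg_coeffs p"
    using pCons.prems by (auto simp: nonneg_coeffs_def coeff_pCons split: nat.splits)
  have "norm (opoly (pCons a p) F x) \<le> norm (a *\<^sub>R x) + norm (F (opoly p F x))"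
    unfolding opoly_pCons[OF assms(1)] by (rule norm_triangle_ineq)
  also have "\<dots> \<le> a * norm x + poly p 1 * norm x"
    using a pCons.IH[OF p] assms(2)[of "opoly p F x"] by simp
  finally show ?case by (simp add: algebra_simps)
qed auto

text \<open>The iteration \<open>y \<mapsto> (z + y\<^sup>2) / 2\<close> converges to \<open>1 - sqrt (1 - z)\<close>.
  Nonnegativity of all coefficients reduces the convergence for a contraction
  to the convergence at \<open>z = 1\<close>.\<close>

fun root_poly :: "nat \<Rightarrow> real poly" where
  "root_poly 0 = 0"
| "root_poly (Suc n) = smult (1/2) ([:0, 1:] + root_poly n * root_poly n)"

lemma nonneg_root_poly: "nonneg_coeffs (root_poly n)"
proof (induction n)
  case (Suc n)
  have "nonneg_coeffs [:0, 1:]"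
    by (auto simp: nonneg_coeffs_def coeff_pCons split: nat.splits)
  then show ?case
    using Suc by (simp add: nonneg_coeffs_smult nonneg_coeffs_add nonneg_coeffs_mult del: smult_add_right)
qed (simp add: nonneg_coeffs_def)

text \<open>By the recursion, each increment is half a difference of squares, that is, half the
  previous increment times the sum of two consecutive iterates. Sums and products keep coefficients
  nonnegative.\<close>

lemma nonneg_root_poly_step: "nonneg_coeffs (root_poly (Suc n) - root_poly n)"
proof (induction n)
  case 0
  show ?case using nonneg_root_poly[of 1] by simp
next
  case (Suc n)
  have "root_poly (Suc (Suc n)) - root_poly (Suc n) =
      smult (1/2) ((root_poly (Suc n) - root_poly n) * (root_poly (Suc n) + root_poly n))"
    by (simp only: root_poly.simps(2)[of "Suc n"] root_poly.simps(2)[of n])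
       (simp add: algebra_simps smult_add_right[symmetric] smult_diff_right[symmetric])
  then show ?case
    using Suc nonneg_root_poly by (metis nonneg_coeffs_add nonneg_coeffs_mult nonneg_coeffs_smult
        zero_le_divide_1_iff zero_le_numeral)
qed

lemma nonneg_root_poly_diff: "n \<le> m \<Longrightarrow> nonneg_coeffs (root_poly m - root_poly n)"
proof (induction m rule: dec_induct)
  case base
  show ?case by (simp add: nonneg_coeffs_def)
next
  case (step k)
  show ?case
    using nonneg_coeffs_add[OF nonneg_root_poly_step[of k] step.IH] by (simp del: root_poly.simps)
qed

lemma poly_root_poly_le_1: "poly (root_poly n) 1 \<le> 1"
proof (induction n)
  case (Suc n)
  have "0 \<le> poly (root_poly n) 1"
    using nonneg_root_poly[of n] unfolding poly_altdef nonneg_coeffs_def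
    by (auto intro!: sum_nonneg)
  then have "poly (root_poly n) 1 * poly (root_poly n) 1 \<le> 1"
    using Suc by (simp add: mult_le_one)
  then show ?case by simp
qed simp

lemma root_poly_tendsto_1: "(\<lambda>n. poly (root_poly n) 1) \<longlonglongrightarrow> 1"
proof -
  let ?a = "\<lambda>n. poly (root_poly n) 1"
  have mono: "incseq ?a"
  proof (rule incseq_SucI)
    fix n
    \<comment> \<open>At 1 the increment from a value \<open>a\<close> is exactly
      \<open>(a - 1)^2 / 2\<close>.\<close>
    have "0 \<le> (?a n - 1)\<^sup>2" by simp
    then show "?a n \<le> ?a (Suc n)" by (simp add: power2_eq_square algebra_simps)
  qed
  obtain L where L: "?a \<longlonglongrightarrow> L"
    using incseq_convergent[OF mono, of 1] poly_root_poly_le_1 by blast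
  have "(\<lambda>n. ?a (Suc n)) \<longlonglongrightarrow> (1 + L * L) / 2"
    using L by (auto intro!: tendsto_eq_intros)
  moreover have "(\<lambda>n. ?a (Suc n)) \<longlonglongrightarrow> L"
    using L by (rule LIMSEQ_Suc)
  ultimately have "L = (1 + L * L) / 2"
    using LIMSEQ_unique by blast
  \<comment> \<open>The fixed-point equation has 1 as a double root, which pins down the
    limit.\<close>
  then have "(L - 1) * (L - 1) = 0"
    by (simp add: field_simps)
  then show ?thesis using L by simp
qed

section \<open>The strong limit of the iteration\<close>

lemma norm_opoly_root_poly_le:
  fixes F :: "'h::real_normed_vector \<Rightarrow> 'h"
  assumes "linear F" "\<And>x. norm (F x) \<le> norm x"
  shows "norm (opoly (root_poly n) F x) \<le> norm x"
proof -
  have "norm (opoly (root_poly n) F x) \<le> poly (root_poly n) 1 * norm x"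
    by (rule norm_opoly_le[OF assms nonneg_root_poly])
  also have "\<dots> \<le> 1 * norm x"
    by (intro mult_right_mono poly_root_poly_le_1) auto
  finally show ?thesis by simp
qed

text \<open>For a contraction the limit exists and is \<open>R = 1 - sqrt (1 - F)\<close>, in the
  sense that \<open>(1 - R)^2 = 1 - F\<close>.\<close>

definition root_op :: "('h::real_normed_vector \<Rightarrow> 'h) \<Rightarrow> 'h \<Rightarrow> 'h" where
  "root_op F x = lim (\<lambda>n. opoly (root_poly n) F x)"

locale contraction =
  fixes F :: "'h::{real_inner,complete_space} \<Rightarrow> 'h"
  assumes linear: "linear F" and norm_le: "norm (F x) \<le> norm x"
begin

lemma root_op_tendsto: "(\<lambda>n. opoly (root_poly n) F x) \<longlonglongrightarrow> root_op F x"
proof -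
  have "Cauchy (\<lambda>n. opoly (root_poly n) F x)"
  proof (rule metric_CauchyI)
    fix e :: real assume e: "0 < e"
    \<comment> \<open>The values at 1 form a scalar majorant: the difference of a later and an
      earlier iterate has nonnegative coefficients, so \<open>norm_opoly_le\<close> bounds it by the
      difference of these values.\<close>
    have "(\<lambda>n. poly (root_poly n) 1 * norm x) \<longlonglongrightarrow> 1 * norm x"
      by (intro tendsto_intros root_poly_tendsto_1)
    then have "Cauchy (\<lambda>n. poly (root_poly n) 1 * norm x)"
      by (rule LIMSEQ_imp_Cauchy)
    then obtain M where M: "\<And>m n. m \<ge> M \<Longrightarrow> n \<ge> M \<Longrightarrow>
        dist (poly (root_poly m) 1 * norm x) (poly (root_poly n) 1 * norm x) < e"
      using metric_CauchyD e by blast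
    have *: "dist (opoly (root_poly m) F x) (opoly (root_poly n) F x) < e"
      if "n \<ge> M" "m \<ge> n" for m n
    proof -
      have "norm (opoly (root_poly m - root_poly n) F x) \<le> poly (root_poly m - root_poly n) 1 * norm x"
        by (rule norm_opoly_le[OF linear norm_le nonneg_root_poly_diff[OF that(2)]])
      also have "\<dots> < e"
        using M[of m n] that by (simp add: dist_real_def algebra_simps)
      finally show ?thesis by (simp add: dist_norm opoly_diff[OF linear])
    qed
    show "\<exists>M. \<forall>m\<ge>M. \<forall>n\<ge>M. dist (opoly (root_poly m) F x) (opoly (root_poly n) F x) < e"
      by (metis * dist_commute nle_le)
  qed
  then show ?thesis
    unfolding root_op_def by (simp add: Cauchy_convergent convergent_LIMSEQ_iff[symmetric])
qed

lemma norm_root_op_le: "norm (root_op F x) \<le> norm x"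
  by (rule LIMSEQ_le_const2[OF tendsto_norm[OF root_op_tendsto]])
     (use norm_opoly_root_poly_le[OF linear norm_le] in auto)

lemma linear_root_op: "linear (root_op F)"
proof (rule linearI)
  show "root_op F (x + y) = root_op F x + root_op F y" for x y
    using tendsto_add[OF root_op_tendsto[of x] root_op_tendsto[of y]] root_op_tendsto[of "x + y"]
    by (simp add: linear_add[OF linear_opoly[OF linear]] LIMSEQ_unique)
  show "root_op F (c *\<^sub>R x) = c *\<^sub>R root_op F x" for c x
    using tendsto_scaleR[OF tendsto_const[of c] root_op_tendsto[of x]] root_op_tendsto[of "c *\<^sub>R x"]
    by (simp add: linear_scale[OF linear_opoly[OF linear]] LIMSEQ_unique)
qed

lemma contraction_root_op: "contraction (root_op F)"
  by (intro contraction.intro linear_root_op norm_root_op_le)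

lemma bounded_linear_root_op: "bounded_linear (root_op F)"
proof (rule bounded_linear_intro[where K = 1])
qed (simp_all add: linear_add[OF linear_root_op] linear_scale[OF linear_root_op] norm_root_op_le)

lemma root_op_commute:
  assumes "bounded_linear C" "\<And>x. C (F x) = F (C x)"
  shows "C (root_op F x) = root_op F (C x)"
proof -
  have "(\<lambda>n. C (opoly (root_poly n) F x)) \<longlonglongrightarrow> C (root_op F x)"
    by (rule bounded_linear.tendsto[OF assms(1) root_op_tendsto])
  then show ?thesis
    using root_op_tendsto[of "C x"]
    by (simp add: opoly_commute[OF linear bounded_linear.linear[OF assms(1)] assms(2)] LIMSEQ_unique)
qed

lemma symmetric_root_op:
  assumes "symmetric_op F"
  shows "symmetric_op (root_op F)"
proof -
  have "root_op F x \<bullet> y = x \<bullet> root_op F y" for x y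
    using tendsto_inner[OF root_op_tendsto[of x] tendsto_const[of y]]
      tendsto_inner[OF tendsto_const[of x] root_op_tendsto[of y]]
    by (simp add: symmetric_opD[OF symmetric_opoly[OF linear assms]] LIMSEQ_unique)
  then show ?thesis by (simp add: symmetric_op_def)
qed

text \<open>Strong limits are compatible with products here because all iterates have norm at most
  1: \<open>Y n (p(Y n) x)\<close> differs from \<open>Y n z\<close> by at most the norm of
  \<open>p(Y n) x - z\<close>, and \<open>Y n z\<close> converges by itself.\<close>

lemma opoly_opoly_root_poly_tendsto:
  "(\<lambda>n. opoly p (opoly (root_poly n) F) x) \<longlonglongrightarrow> opoly p (root_op F) x"
proof (induction p)
  case (pCons a p)
  let ?Y = "\<lambda>n. opoly (root_poly n) F" and ?z = "opoly p (root_op F) x"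
  have "(\<lambda>n. ?Y n (opoly p (?Y n) x) - ?Y n ?z) \<longlonglongrightarrow> 0"
  proof (rule Lim_null_comparison)
    show "\<forall>\<^sub>F n in sequentially. norm (?Y n (opoly p (?Y n) x) - ?Y n ?z) \<le> norm (opoly p (?Y n) x - ?z)"
      using norm_opoly_root_poly_le[OF linear norm_le]
      by (auto simp flip: linear_diff[OF linear_opoly[OF linear]])
    show "(\<lambda>n. norm (opoly p (?Y n) x - ?z)) \<longlonglongrightarrow> 0"
      using pCons.IH by (simp add: tendsto_norm_zero_iff LIM_zero_iff)
  qed
  from tendsto_add[OF this root_op_tendsto[of ?z]]
  have "(\<lambda>n. ?Y n (opoly p (?Y n) x)) \<longlonglongrightarrow> root_op F ?z"
    by simp
  then show ?case
    by (auto simp: opoly_pCons[OF linear_opoly[OF linear]] opoly_pCons[OF linear_root_op]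
        intro!: tendsto_intros)
qed auto

text \<open>The recursion in the limit; rearranged, it says \<open>(1 - R)^2 = 1 - F\<close> for
  \<open>R = root_op F\<close>.\<close>

lemma root_op_eq: "root_op F (root_op F x) = 2 *\<^sub>R root_op F x - F x"
proof -
  have sq: "(\<lambda>n. opoly (root_poly n) F (opoly (root_poly n) F x)) \<longlonglongrightarrow> root_op F (root_op F x)"
    using opoly_opoly_root_poly_tendsto[of "[:0, 0, 1:]" x]
    by (simp add: opoly_pCons[OF linear_opoly[OF linear]] opoly_pCons[OF linear_root_op]
        linear_0[OF linear_opoly[OF linear]] linear_0[OF linear_root_op])
  have "(\<lambda>n. 2 *\<^sub>R opoly (root_poly (Suc n)) F x - F x) \<longlonglongrightarrow> 2 *\<^sub>R root_op F x - F x"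
    by (intro tendsto_intros LIMSEQ_Suc root_op_tendsto)
  moreover have "2 *\<^sub>R opoly (root_poly (Suc n)) F x - F x =
      opoly (root_poly n) F (opoly (root_poly n) F x)" for n
  proof -
    have "2 *\<^sub>R opoly (root_poly (Suc n)) F x =
        opoly ([:0, 1:] + root_poly n * root_poly n) F x"
      by (simp only: root_poly.simps opoly_smult[OF linear]) simp
    then show ?thesis
      by (simp add: opoly_add[OF linear] opoly_mult[OF linear] opoly_pCons[OF linear] linear_0[OF linear])
  qed
  ultimately show ?thesis
    using sq LIMSEQ_unique by simp
qed

lemma diff_root_op_pos: "0 \<le> (x - root_op F x) \<bullet> x"
proof -
  have "root_op F x \<bullet> x \<le> norm (root_op F x) * norm x" by (rule norm_cauchy_schwarz)
  also have "\<dots> \<le> norm x * norm x" by (intro mult_right_mono norm_root_op_le) auto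
  finally show ?thesis by (simp add: inner_diff_left dot_square_norm power2_eq_square)
qed

end

section \<open>The modulus of a bounded symmetric operator\<close>

lemma symmetric_pos_cauchy_schwarz:
  assumes "linear F" "symmetric_op F" "\<And>x. 0 \<le> F x \<bullet> x"
  shows "(F x \<bullet> y)\<^sup>2 \<le> (F x \<bullet> x) * (F y \<bullet> y)"
proof -
  let ?a = "F x \<bullet> x" and ?b = "F x \<bullet> y" and ?c = "F y \<bullet> y"
  have q: "0 \<le> ?a - 2 * t * ?b + t\<^sup>2 * ?c" for t
  proof -
    have "F y \<bullet> x = ?b"
      using symmetric_opD[OF assms(2), of y x] by (simp add: inner_commute)
    then have "F (x - t *\<^sub>R y) \<bullet> (x - t *\<^sub>R y) = ?a - 2 * t * ?b + t\<^sup>2 * ?c"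
      by (simp add: linear_diff[OF assms(1)] linear_scale[OF assms(1)] inner_diff_left inner_diff_right
          power2_eq_square algebra_simps)
    then show ?thesis using assms(3)[of "x - t *\<^sub>R y"] by simp
  qed
  show ?thesis
  proof (cases "?c = 0")
    case True
    have "?b = 0"
    proof (rule ccontr)
      assume "?b \<noteq> 0"
      \<comment> \<open>With \<open>?c = 0\<close> the form is affine in \<open>t\<close>, and at
        this \<open>t\<close> it would take the value -1.\<close>
      then show False using q[of "(?a + 1) / (2 * ?b)"] True by (simp add: field_simps)
    qed
    then show ?thesis using True by simp
  next
    case False
    then have c: "?c > 0" using assms(3)[of y] by simp
    have "0 \<le> ?a - ?b\<^sup>2 / ?c"
      \<comment> \<open>This \<open>t\<close> minimizes the quadratic.\<close>
      using q[of "?b / ?c"] c by (simp add: power2_eq_square field_simps)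
    then show ?thesis using c by (simp add: field_simps)
  qed
qed

lemma norm_diff_pos_le:
  assumes P: "linear P" "symmetric_op P" "\<And>x. 0 \<le> P x \<bullet> x"
    and Q: "linear Q" "symmetric_op Q" "\<And>x. 0 \<le> Q x \<bullet> x"
    and comm: "\<And>x. P (Q x) = Q (P x)"
  shows "norm (P d - Q d) ^ 3 \<le> 2 * norm (P (P d) - Q (Q d)) * (P d \<bullet> d + Q d \<bullet> d)"
proof -
  define u where "u = P d - Q d"
  define r where "r = P (P d) - Q (Q d)"
  define a where "a = P d \<bullet> d"
  define b where "b = Q d \<bullet> d"
  have ab: "0 \<le> a" "0 \<le> b" using P(3) Q(3) by (auto simp: a_def b_def)
  \<comment> \<open>Commutativity cancels the mixed terms.\<close>
  have "P u + Q u = r"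
    by (simp add: u_def r_def linear_diff[OF P(1)] linear_diff[OF Q(1)] comm)
  then have "P u \<bullet> u + Q u \<bullet> u = r \<bullet> u"
    by (simp add: inner_add_left[symmetric])
  then have pq: "P u \<bullet> u + Q u \<bullet> u \<le> norm r * norm u"
    using norm_cauchy_schwarz[of r u] by simp
  \<comment> \<open>Moving \<open>P\<close> and \<open>Q\<close> onto \<open>u\<close> leaves only
    pairings with \<open>d\<close>. Cauchy-Schwarz for each form then splits off the values at
    \<open>u\<close>, whose sum is controlled by \<open>pq\<close>.\<close>
  have "(norm u)\<^sup>2 = u \<bullet> (P d - Q d)"
    by (simp add: u_def dot_square_norm)
  also have "\<dots> = P u \<bullet> d - Q u \<bullet> d"
    by (simp add: inner_diff_right symmetric_opD[OF P(2)] symmetric_opD[OF Q(2)])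
  finally have u2: "(norm u)\<^sup>2 = P u \<bullet> d - Q u \<bullet> d" .
  have "norm u ^ 4 = (P u \<bullet> d - Q u \<bullet> d)\<^sup>2"
    by (simp add: u2[symmetric] power_mult[symmetric])
  also have "\<dots> \<le> 2 * ((P u \<bullet> d)\<^sup>2 + (Q u \<bullet> d)\<^sup>2)"
    using zero_le_power2[of "P u \<bullet> d + Q u \<bullet> d"] by (simp add: power2_eq_square algebra_simps)
  also have "\<dots> \<le> 2 * ((P u \<bullet> u) * a + (Q u \<bullet> u) * b)"
    unfolding a_def b_def
    by (intro mult_left_mono add_mono symmetric_pos_cauchy_schwarz P Q) auto
  \<comment> \<open>The cross terms added here are products of nonnegative numbers.\<close>
  also have "\<dots> \<le> 2 * ((P u \<bullet> u + Q u \<bullet> u) * (a + b))"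
    using ab P(3)[of u] Q(3)[of u] by (simp add: algebra_simps)
  also have "\<dots> \<le> 2 * ((norm r * norm u) * (a + b))"
    by (intro mult_left_mono mult_right_mono pq) (use ab in auto)
  finally have "norm u * norm u ^ 3 \<le> norm u * (2 * norm r * (a + b))"
    by (simp add: algebra_simps power_numeral_reduce)
  then have "norm u ^ 3 \<le> 2 * norm r * (a + b)"
    using ab by (cases "norm u = 0") (auto simp: mult_le_cancel_left_pos)
  then show ?thesis by (simp add: u_def r_def a_def b_def)
qed

section \<open>Construction, uniqueness and approximation of the modulus\<close>

locale bounded_symmetric =
  fixes A :: "'h::{real_inner,complete_space} \<Rightarrow> 'h" and N :: real
  assumes linear: "linear A" and symmetric: "symmetric_op A"
    and N_pos: "0 < N" and norm_le: "norm (A x) \<le> N * norm x"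
begin

text \<open>This is \<open>F = 1 - (A/N)^2\<close>, chosen so that \<open>1 - F = (A/N)^2\<close>
  and \<open>root_op F\<close> becomes \<open>1 - |A|/N\<close>.\<close>

definition complement :: "'h \<Rightarrow> 'h" where
  "complement x = x - (1 / N\<^sup>2) *\<^sub>R A (A x)"

lemma complement_eq_opoly: "complement = opoly [:1, 0, - 1 / N\<^sup>2:] A"
  by (auto simp: complement_def opoly_pCons[OF linear] linear_0[OF linear] linear_add[OF linear]
      linear_scale[OF linear] linear_diff[OF linear] linear_neg[OF linear])

lemma bounded_linear: "bounded_linear A"
  using linear norm_le
  by (intro bounded_linear_intro[where K = N])
     (auto simp: linear_add[OF linear] linear_scale[OF linear] mult.commute)

text \<open>Put \<open>B = A/N\<close>. By symmetry the squared norm of \<open>x - B (B x)\<close>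
  is that of \<open>x\<close>, minus twice that of \<open>B x\<close>, plus that of
  \<open>B (B x)\<close>; the last term is at most the squared norm of \<open>B x\<close>.\<close>

lemma contraction_complement: "contraction complement"
proof (rule contraction.intro)
  show "linear complement"
    unfolding complement_eq_opoly by (rule linear_opoly[OF linear])
  show "norm (complement x) \<le> norm x" for x
  proof -
    let ?c = "1 / N\<^sup>2"
    have c: "0 < ?c" using N_pos by simp
    have "(norm (A (A x)))\<^sup>2 \<le> (N * norm (A x))\<^sup>2"
      by (intro power_mono norm_le) auto
    then have *: "?c * (norm (A (A x)))\<^sup>2 \<le> (norm (A x))\<^sup>2"
      using N_pos by (simp add: field_simps)
    have "A (A x) \<bullet> x = (norm (A x))\<^sup>2"
      by (simp add: symmetric_opD[OF symmetric] dot_square_norm)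
    then have "(norm (complement x))\<^sup>2 =
        (norm x)\<^sup>2 - 2 * ?c * (norm (A x))\<^sup>2 + ?c * (?c * (norm (A (A x)))\<^sup>2)"
      using power_add[of N 2 2]
      by (simp add: complement_def dot_square_norm[symmetric] inner_diff_left inner_diff_right
          inner_commute[of x "A (A x)"] diff_divide_distrib)
    also have "\<dots> \<le> (norm x)\<^sup>2 - 2 * ?c * (norm (A x))\<^sup>2 + ?c * (norm (A x))\<^sup>2"
      by (intro add_left_mono mult_left_mono *) (use c in auto)
    also have "\<dots> \<le> (norm x)\<^sup>2"
      using c by simp
    finally show ?thesis by (rule power2_le_imp_le) simp
  qed
qed

sublocale complement: contraction complement by (rule contraction_complement)

definition modulus :: "'h \<Rightarrow> 'h" where
  "modulus x = N *\<^sub>R (x - root_op complement x)"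

lemma bounded_linear_modulus: "bounded_linear modulus"
  unfolding modulus_def[abs_def]
  by (intro bounded_linear_compose[OF bounded_linear_scaleR_right] bounded_linear_sub
      bounded_linear_ident complement.bounded_linear_root_op)

lemma modulus_pos: "0 \<le> modulus x \<bullet> x"
  using complement.diff_root_op_pos[of x] N_pos by (simp add: modulus_def)

lemma symmetric_modulus: "symmetric_op modulus"
proof -
  have "symmetric_op complement"
    unfolding complement_eq_opoly by (rule symmetric_opoly[OF linear symmetric])
  from symmetric_opD[OF complement.symmetric_root_op[OF this]] show ?thesis
    by (simp add: symmetric_op_def modulus_def inner_diff_left inner_diff_right)
qed

lemma modulus_modulus: "modulus (modulus x) = A (A x)"
proof -
  have "modulus (modulus x) = N\<^sup>2 *\<^sub>R (x - complement x)"
    by (simp add: modulus_def linear_diff[OF complement.linear_root_op] linear_scale[OF complement.linear_root_op]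
        complement.root_op_eq scaleR_2 power2_eq_square algebra_simps)
  then show ?thesis using N_pos by (simp add: complement_def)
qed

text \<open>Commuting with the square of \<open>A\<close> is enough, since \<open>complement\<close>
  is built from that square and \<open>root_op\<close> is a pointwise limit of polynomials in
  \<open>complement\<close>.\<close>

lemma modulus_commute:
  assumes C: "bounded_linear C" "\<And>x. C (A (A x)) = A (A (C x))"
  shows "C (modulus x) = modulus (C x)"
proof -
  have "C (complement x) = complement (C x)" for x
    using bounded_linear.linear[OF C(1)] C(2)
    by (simp add: complement_def linear_diff linear_scale)
  from complement.root_op_commute[OF C(1) this] show ?thesis
    using bounded_linear.linear[OF C(1)] by (simp add: modulus_def linear_diff linear_scale)
qed

lemma norm_modulus: "norm (modulus x) = norm (A x)"
proof -
  have "(norm (modulus x))\<^sup>2 = modulus (modulus x) \<bullet> x"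
    by (simp add: symmetric_opD[OF symmetric_modulus] dot_square_norm)
  also have "\<dots> = (norm (A x))\<^sup>2"
    by (simp add: modulus_modulus symmetric_opD[OF symmetric] dot_square_norm)
  finally show ?thesis by simp
qed

text \<open>Any such \<open>P\<close> commutes with its own square, which is that of
  \<open>A\<close>, hence with \<open>modulus\<close>. The right-hand side of
  \<open>norm_diff_pos_le\<close> is then zero.\<close>

lemma modulus_unique:
  assumes P: "bounded_linear P" "symmetric_op P" "\<And>x. 0 \<le> P x \<bullet> x"
    and sq: "\<And>x. P (P x) = A (A x)"
  shows "P = modulus"
proof
  fix x
  have "P (modulus x) = modulus (P x)" for x
    by (rule modulus_commute[OF P(1)]) (simp add: sq[symmetric])
  from norm_diff_pos_le[OF bounded_linear.linear[OF P(1)] P(2,3)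
      bounded_linear.linear[OF bounded_linear_modulus] symmetric_modulus modulus_pos this, of x]
  show "P x = modulus x" by (simp add: sq modulus_modulus)
qed

text \<open>Applying the square root twice makes the approximating polynomials of the modulus squares,
  so that they stay positive on every symmetric operator, whatever its norm.\<close>

lemma modulus_approx:
  assumes e: "0 < e"
  shows "\<exists>s. norm (opoly (s * s) A x - modulus x) < e \<and>
             norm (opoly ((s * s) * (s * s)) A x - A (A x)) < e"
proof -
  let ?Y = "root_op complement"
  interpret Y: contraction ?Y by (rule complement.contraction_root_op)
  let ?Z = "root_op ?Y"
  \<comment> \<open>Here \<open>?Y\<close> is \<open>1 - |A|/N\<close> and \<open>?Z\<close> is
    \<open>1 - sqrt (|A|/N)\<close>, so \<open>g\<close> at \<open>?Z\<close> is the square root of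
    the modulus.\<close>
  define g where "g = smult (sqrt N) [:1, -1:]"
  have g: "opoly g ?Z y = sqrt N *\<^sub>R (y - ?Z y)" for y
    unfolding g_def opoly_smult[OF Y.linear_root_op]
    by (simp add: opoly_pCons[OF Y.linear_root_op] linear_neg[OF Y.linear_root_op]
        linear_0[OF Y.linear_root_op])
  have g2: "opoly (g * g) ?Z y = modulus y" for y
    using N_pos unfolding opoly_mult[OF Y.linear_root_op] g
    by (simp add: modulus_def linear_diff[OF Y.linear_root_op] linear_scale[OF Y.linear_root_op]
        Y.root_op_eq scaleR_2 algebra_simps)
  then have g4: "opoly ((g * g) * (g * g)) ?Z y = A (A y)" for y
    by (simp only: opoly_mult[OF Y.linear_root_op, of "g * g"] modulus_modulus)
  have e2: "0 < e / 2" using e by simp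
  \<comment> \<open>Two successive approximations at the vector \<open>x\<close>, each costing
    \<open>e / 2\<close>: first \<open>?Z\<close> by a polynomial in \<open>?Y\<close>, then, with
    \<open>m\<close> fixed, \<open>?Y\<close> by a polynomial in \<open>complement\<close>.\<close>
  from eventually_happens'[OF sequentially_bot eventually_conj[OF
      tendstoD[OF Y.opoly_opoly_root_poly_tendsto[of "g * g" x] e2]
      tendstoD[OF Y.opoly_opoly_root_poly_tendsto[of "(g * g) * (g * g)" x] e2]]]
  obtain m where m:
    "dist (opoly (g * g) (opoly (root_poly m) ?Y) x) (modulus x) < e / 2"
    "dist (opoly ((g * g) * (g * g)) (opoly (root_poly m) ?Y) x) (A (A x)) < e / 2"
    unfolding g2 g4 by blast
  define h where "h = pcompose g (root_poly m)"
  have h2: "opoly (g * g) (opoly (root_poly m) ?Y) x = opoly (h * h) ?Y x"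
    and h4: "opoly ((g * g) * (g * g)) (opoly (root_poly m) ?Y) x = opoly ((h * h) * (h * h)) ?Y x"
    by (simp_all only: h_def opoly_pcompose[OF complement.linear_root_op, symmetric] pcompose_mult)
  from eventually_happens'[OF sequentially_bot eventually_conj[OF
      tendstoD[OF complement.opoly_opoly_root_poly_tendsto[of "h * h" x] e2]
      tendstoD[OF complement.opoly_opoly_root_poly_tendsto[of "(h * h) * (h * h)" x] e2]]]
  obtain n where n:
    "dist (opoly (h * h) (opoly (root_poly n) complement) x) (opoly (h * h) ?Y x) < e / 2"
    "dist (opoly ((h * h) * (h * h)) (opoly (root_poly n) complement) x)
       (opoly ((h * h) * (h * h)) ?Y x) < e / 2"
    by blast
  \<comment> \<open>Substituting the quadratic polynomial for \<open>complement\<close> gives a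
    polynomial in \<open>A\<close>. Composition preserves products, so the square form
    survives.\<close>
  define s where "s = pcompose (pcompose h (root_poly n)) [:1, 0, - 1 / N\<^sup>2:]"
  have s: "opoly (pcompose (pcompose f (root_poly n)) [:1, 0, - 1 / N\<^sup>2:]) A x =
      opoly f (opoly (root_poly n) complement) x" for f
    by (simp only: opoly_pcompose[OF linear, of _ "[:1, 0, - 1 / N\<^sup>2:]"]
        complement_eq_opoly[symmetric] opoly_pcompose[OF complement.linear])
  have s2: "opoly (h * h) (opoly (root_poly n) complement) x = opoly (s * s) A x"
    and s4: "opoly ((h * h) * (h * h)) (opoly (root_poly n) complement) x =
      opoly ((s * s) * (s * s)) A x"
    unfolding s[symmetric] s_def by (simp_all only: pcompose_mult)
  have "norm (opoly (s * s) A x - modulus x) < e"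
    using le_less_trans[OF dist_triangle add_strict_mono[OF n(1) m(1)[unfolded h2]]]
    unfolding s2 dist_norm field_sum_of_halves .
  moreover have "norm (opoly ((s * s) * (s * s)) A x - A (A x)) < e"
    using le_less_trans[OF dist_triangle add_strict_mono[OF n(2) m(2)[unfolded h4]]]
    unfolding s4 dist_norm field_sum_of_halves .
  ultimately show ?thesis by blast
qed

text \<open>The form of \<open>opoly (s * s) A\<close> is nonnegative because its value at
  \<open>x\<close> is the squared norm of \<open>opoly s A x\<close>. Bounding the form of the
  modulus by \<open>norm (A d)\<close> makes the right-hand side depend on moments of
  \<open>A\<close> alone.\<close>

lemma modulus_close:
  assumes "norm d = 1"
  shows "norm (modulus d - opoly (s * s) A d) ^ 3 \<le>
    2 * norm (A (A d) - opoly ((s * s) * (s * s)) A d) * (norm (A d) + opoly (s * s) A d \<bullet> d)"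
proof -
  let ?Q = "opoly (s * s) A"
  have lin: "linear ?Q" and sym: "symmetric_op ?Q"
    by (rule linear_opoly[OF linear], rule symmetric_opoly[OF linear symmetric])
  have pos: "0 \<le> ?Q x \<bullet> x" for x
    unfolding opoly_mult[OF linear]
    by (subst symmetric_opD[OF symmetric_opoly[OF linear symmetric]]) simp
  have "A (modulus x) = modulus (A x)" for x
    by (rule modulus_commute[OF bounded_linear]) simp
  then have comm: "modulus (?Q x) = ?Q (modulus x)" for x
    by (intro opoly_commute[OF linear bounded_linear.linear[OF bounded_linear_modulus]]) simp
  have "modulus d \<bullet> d \<le> norm (A d)"
    using norm_cauchy_schwarz[of "modulus d" d] assms by (simp add: norm_modulus)
  then have "2 * norm (A (A d) - ?Q (?Q d)) * (modulus d \<bullet> d + ?Q d \<bullet> d) \<le>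
      2 * norm (A (A d) - ?Q (?Q d)) * (norm (A d) + ?Q d \<bullet> d)"
    by (intro mult_left_mono add_right_mono) auto
  with norm_diff_pos_le[OF bounded_linear.linear[OF bounded_linear_modulus] symmetric_modulus
      modulus_pos lin sym pos comm, of d]
  show ?thesis by (simp only: modulus_modulus opoly_mult[OF linear, of "s * s"])
qed

end

section \<open>Continuity of the modulus under eventual equality of moments\<close>

text \<open>A polynomial involves finitely many moments, so finitely many eventual equalities are
  combined. The starting power \<open>k\<close> is general because peeling off one coefficient moves
  an application of the operator onto the vector.\<close>

lemma opoly_moments_eq:
  fixes A :: "nat \<Rightarrow> 'h::real_inner \<Rightarrow> 'h" and B :: "'k::real_inner \<Rightarrow> 'k"
  assumes "\<forall>\<^sub>F n in sequentially. linear (A n)" "linear B"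
    and "\<And>k. \<forall>\<^sub>F n in sequentially. (A n ^^ k) (d n) \<bullet> d n = (B ^^ k) e \<bullet> e"
  shows "\<forall>\<^sub>F n in sequentially.
    opoly p (A n) ((A n ^^ k) (d n)) \<bullet> d n = opoly p B ((B ^^ k) e) \<bullet> e"
proof (induction p arbitrary: k)
  case (pCons a p)
  show ?case
    using assms(1) assms(3)[of k] pCons.IH[of "Suc k"]
  proof eventually_elim
    case (elim n)
    then show ?case
      using opoly_commute[OF elim(1) elim(1), of p "(A n ^^ k) (d n)"]
        opoly_commute[OF assms(2) assms(2), of p "(B ^^ k) e"]
      by (simp add: opoly_pCons[OF elim(1)] opoly_pCons[OF assms(2)] inner_add_left)
  qed
qed simp

theorem modulus_moment_continuity:
  fixes A :: "nat \<Rightarrow> 'h::{real_inner,complete_space} \<Rightarrow> 'h"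
    and B :: "'k::{real_inner,complete_space} \<Rightarrow> 'k"
  assumes A: "\<forall>\<^sub>F n in sequentially. bounded_symmetric (A n) (N n)" and B: "bounded_symmetric B M"
    and d: "\<forall>\<^sub>F n in sequentially. norm (d n) = 1" and e: "norm e = 1"
    and mom: "\<And>k. \<forall>\<^sub>F n in sequentially. (A n ^^ k) (d n) \<bullet> d n = (B ^^ k) e \<bullet> e"
  shows "(\<lambda>n. bounded_symmetric.modulus (A n) (N n) (d n) \<bullet> d n)
    \<longlonglongrightarrow> bounded_symmetric.modulus B M e \<bullet> e"
proof (rule tendstoI)
  fix eps :: real assume eps: "0 < eps"
  interpret B: bounded_symmetric B M by (rule B)
  have linA: "\<forall>\<^sub>F n in sequentially. linear (A n)"
    using A by eventually_elim (rule bounded_symmetric.linear)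
  \<comment> \<open>\<open>K\<close> will bound \<open>norm (B e)\<close> plus the form of
    \<open>q(B)\<close> at \<open>e\<close>; the summand 1 absorbs the approximation error, which is
    less than \<open>\<eta>\<close> and hence less than 1.\<close>
  define K where "K = norm (B e) + norm (B.modulus e) + 1"
  have K: "1 \<le> K" by (simp add: K_def)
  \<comment> \<open>The bound 1 serves \<open>K\<close>, the bound \<open>eps / 2\<close> the last
    triangle inequality, and the third the cubic estimate; its extra halving makes that estimate
    strict.\<close>
  define \<eta> where "\<eta> = min (min 1 (eps / 2)) ((eps / 2) ^ 3 / (2 * K) / 2)"
  have \<eta>: "0 < \<eta>" "\<eta> \<le> 1" "\<eta> \<le> eps / 2" "2 * \<eta> * K < (eps / 2) ^ 3"
  proof -
    have *: "0 < (eps / 2) ^ 3 / (2 * K)" using eps K by simp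
    then show "0 < \<eta>" "\<eta> \<le> 1" "\<eta> \<le> eps / 2" using eps by (auto simp: \<eta>_def)
    have "\<eta> < (eps / 2) ^ 3 / (2 * K)" using * unfolding \<eta>_def min_less_iff_disj by simp
    then show "2 * \<eta> * K < (eps / 2) ^ 3" using K by (simp add: field_simps)
  qed
  obtain s where s: "norm (opoly (s * s) B e - B.modulus e) < \<eta>"
    "norm (opoly ((s * s) * (s * s)) B e - B (B e)) < \<eta>"
    using B.modulus_approx[OF \<eta>(1)] by blast
  define q where "q = s * s"
  \<comment> \<open>\<open>t\<close> evaluates to the difference of squares occurring in
    \<open>modulus_close\<close>.\<close>
  define t where "t = [:0, 0, 1:] - q * q"
  have t: "opoly t F x = F (F x) - opoly (q * q) F x" if "linear F"
    for F :: "'x::real_inner \<Rightarrow> 'x" and x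
    using that by (simp add: t_def opoly_diff opoly_pCons linear_0)
  have sq: "(norm (opoly p F x))\<^sup>2 = opoly (p * p) F x \<bullet> x" if "linear F" "symmetric_op F"
    for F :: "'x::real_inner \<Rightarrow> 'x" and x p
    using that
    by (simp add: opoly_mult symmetric_opD[OF symmetric_opoly[OF that]] dot_square_norm)
  have X: "opoly [:0, 1:] F x = F x" if "linear F" for F :: "'x::real_inner \<Rightarrow> 'x" and x
    using that by (simp add: opoly_pCons linear_0)
  have qe: "\<bar>opoly q B e \<bullet> e - B.modulus e \<bullet> e\<bar> < \<eta>"
  proof -
    have "\<bar>(opoly q B e - B.modulus e) \<bullet> e\<bar> \<le> norm (opoly q B e - B.modulus e) * norm e"
      by (rule Cauchy_Schwarz_ineq2)
    then show ?thesis using s(1) e by (simp add: q_def inner_diff_left)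
  qed
  have "B.modulus e \<bullet> e \<le> norm (B.modulus e)"
    using norm_cauchy_schwarz[of "B.modulus e" e] e by simp
  then have qK: "norm (B e) + opoly q B e \<bullet> e \<le> K"
    using qe \<eta>(2) by (simp add: K_def)
  have "\<forall>\<^sub>F n in sequentially. opoly p (A n) (d n) \<bullet> d n = opoly p B e \<bullet> e" for p
    using opoly_moments_eq[OF linA B.linear mom, of p 0] by simp
  \<comment> \<open>By symmetry, a squared norm of \<open>p(F) x\<close> is the form of
    \<open>p * p\<close> at \<open>x\<close>. These three polynomials thus determine the form of
    \<open>q(A n)\<close>, the residual and the norm of \<open>A n (d n)\<close>, all the data that
    \<open>modulus_close\<close> needs.\<close>
  note ev = this[of q] this[of "t * t"] this[of "[:0, 1:] * [:0, 1:]"]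
  show "\<forall>\<^sub>F n in sequentially. dist (bounded_symmetric.modulus (A n) (N n) (d n) \<bullet> d n)
      (B.modulus e \<bullet> e) < eps"
    using A d ev
  proof eventually_elim
    case (elim n)
    interpret A: bounded_symmetric "A n" "N n" by (rule elim)
    let ?P = "A.modulus (d n)" and ?Q = "opoly q (A n) (d n)"
    have "(norm (opoly t (A n) (d n)))\<^sup>2 = (norm (opoly t B e))\<^sup>2"
      using elim(4) by (simp only: sq[OF A.linear A.symmetric] sq[OF B.linear B.symmetric])
    then have "norm (opoly t (A n) (d n)) = norm (opoly t B e)" by simp
    then have r: "norm (A n (A n (d n)) - opoly (q * q) (A n) (d n)) < \<eta>"
      using s(2) by (simp add: t[OF A.linear] t[OF B.linear] q_def norm_minus_commute)
    have "(norm (A n (d n)))\<^sup>2 = (norm (B e))\<^sup>2"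
      using elim(5)
      by (simp only: sq[OF A.linear A.symmetric, symmetric] sq[OF B.linear B.symmetric, symmetric]
          X[OF A.linear] X[OF B.linear])
    then have nA: "norm (A n (d n)) = norm (B e)" by simp
    have nonneg: "0 \<le> ?Q \<bullet> d n"
      using sq[OF A.linear A.symmetric, of s "d n"] by (simp add: q_def[symmetric]) (metis zero_le_power2)
    have "norm (?P - ?Q) ^ 3 \<le> 2 * norm (A n (A n (d n)) - opoly (q * q) (A n) (d n)) *
        (norm (A n (d n)) + ?Q \<bullet> d n)"
      unfolding q_def by (rule A.modulus_close[OF elim(2)])
    also have "\<dots> \<le> 2 * \<eta> * K"
      by (intro mult_mono) (use r nA elim(3) qK nonneg \<eta>(1) in auto)
    also have "\<dots> < (eps / 2) ^ 3" by (rule \<eta>(4))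
    finally have "norm (?P - ?Q) < eps / 2"
      by (rule power_less_imp_less_base) (use eps in simp)
    moreover have "\<bar>(?P - ?Q) \<bullet> d n\<bar> \<le> norm (?P - ?Q) * norm (d n)"
      by (rule Cauchy_Schwarz_ineq2)
    ultimately have "\<bar>?P \<bullet> d n - opoly q B e \<bullet> e\<bar> < eps / 2"
      using elim(2,3) by (simp add: inner_diff_left)
    then show ?case using qe \<eta>(3) unfolding dist_real_def by linarith
  qed
qed

section \<open>The Hilbert space of square-summable functions\<close>

definition square_summable :: "('a \<Rightarrow> complex) \<Rightarrow> bool" where
  "square_summable f \<longleftrightarrow> (\<lambda>x. (cmod (f x))\<^sup>2) summable_on UNIV"

lemma square_summableI:
  assumes "\<And>F. finite F \<Longrightarrow> (\<Sum>x\<in>F. (cmod (f x))\<^sup>2) \<le> C"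
  shows "square_summable f"
  unfolding square_summable_def
  by (rule nonneg_bdd_above_summable_on) (auto intro!: bdd_aboveI2[of _ _ C] assms)

lemma square_summable_0: "square_summable (\<lambda>x. 0)"
  by (simp add: square_summable_def)

lemma square_summable_cmult:
  assumes "square_summable f"
  shows "square_summable (\<lambda>x. c * f x)"
  using summable_on_cmult_right[of "\<lambda>x. (cmod (f x))\<^sup>2" UNIV "(cmod c)\<^sup>2"] assms
  by (simp add: square_summable_def norm_mult power_mult_distrib)

lemma square_summable_add:
  assumes "square_summable f" "square_summable g"
  shows "square_summable (\<lambda>x. f x + g x)"
proof -
  have "(\<lambda>x. 2 * ((cmod (f x))\<^sup>2 + (cmod (g x))\<^sup>2)) summable_on UNIV"
    using assms unfolding square_summable_def by (intro summable_on_cmult_right summable_on_add)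
  moreover have "(cmod (f x + g x))\<^sup>2 \<le> 2 * ((cmod (f x))\<^sup>2 + (cmod (g x))\<^sup>2)" for x
    using power_mono[OF norm_triangle_ineq[of "f x" "g x"], of 2]
      sum_squares_bound[of "cmod (f x)" "cmod (g x)"]
    by (simp add: power2_eq_square algebra_simps)
  ultimately show ?thesis
    unfolding square_summable_def by (rule summable_on_comparison_test) auto
qed

lemma square_summable_uminus: "square_summable f \<Longrightarrow> square_summable (\<lambda>x. - f x)"
  by (simp add: square_summable_def)

lemma square_summable_diff:
  "square_summable f \<Longrightarrow> square_summable g \<Longrightarrow> square_summable (\<lambda>x. f x - g x)"
  using square_summable_add[OF _ square_summable_uminus, of f g] by simp

lemma square_summable_restrict:
  assumes "square_summable f"
  shows "square_summable (\<lambda>x. if x \<in> V then f x else 0)"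
  using assms unfolding square_summable_def by (rule summable_on_comparison_test) auto

lemma square_summable_mult:
  assumes "square_summable f" "square_summable g"
  shows "(\<lambda>x. f x * cnj (g x)) summable_on UNIV"
proof -
  have "(\<lambda>x. (cmod (f x))\<^sup>2 + (cmod (g x))\<^sup>2) summable_on UNIV"
    using assms unfolding square_summable_def by (rule summable_on_add)
  then have "(\<lambda>x. norm (f x * cnj (g x))) summable_on UNIV"
  proof (rule summable_on_comparison_test)
    show "cmod (f x * cnj (g x)) \<le> (cmod (f x))\<^sup>2 + (cmod (g x))\<^sup>2" for x
      using sum_squares_bound[of "cmod (f x)" "cmod (g x)"]
        mult_nonneg_nonneg[OF norm_ge_zero[of "f x"] norm_ge_zero[of "g x"]]
      unfolding norm_mult complex_mod_cnj mult.assoc by linarith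
  qed auto
  then show ?thesis by (rule abs_summable_summable)
qed

lemma inner_complex_eq: "a \<bullet> b = Re (a * cnj b)" for a b :: complex
  by (simp add: inner_complex_def)

lemma square_summable_inner:
  assumes "square_summable f" "square_summable g"
  shows "(\<lambda>x. f x \<bullet> g x) summable_on UNIV"
  using summable_on_Re[OF square_summable_mult[OF assms]] by (simp only: inner_complex_eq)

section \<open>The Hilbert space over a whole type, with the real part of the complex inner
  product\<close>

typedef 'a l2 = "{f :: 'a \<Rightarrow> complex. square_summable f}"
  morphisms coord Abs_l2
  using square_summable_0 by auto

setup_lifting type_definition_l2

lemma square_summable_coord: "square_summable (coord f)"
  using coord[of f] by simp

lemma l2_eqI: "(\<And>x. coord f x = coord g x) \<Longrightarrow> f = g"
  by (metis coord_inject ext)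

lemma coord_Abs_l2: "square_summable f \<Longrightarrow> coord (Abs_l2 f) = f"
  by (simp add: Abs_l2_inverse)

instantiation l2 :: (type) real_vector
begin

lift_definition zero_l2 :: "'a l2" is "\<lambda>x. 0" by (rule square_summable_0)
lift_definition plus_l2 :: "'a l2 \<Rightarrow> 'a l2 \<Rightarrow> 'a l2" is "\<lambda>f g x. f x + g x"
  by (rule square_summable_add)
lift_definition minus_l2 :: "'a l2 \<Rightarrow> 'a l2 \<Rightarrow> 'a l2" is "\<lambda>f g x. f x - g x"
  by (rule square_summable_diff)
lift_definition uminus_l2 :: "'a l2 \<Rightarrow> 'a l2" is "\<lambda>f x. - f x"
  by (rule square_summable_uminus)
lift_definition scaleR_l2 :: "real \<Rightarrow> 'a l2 \<Rightarrow> 'a l2" is "\<lambda>c f x. complex_of_real c * f x"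
  by (rule square_summable_cmult)

instance
  by standard (transfer; simp add: algebra_simps)+

end

lemma coord_simps [simp]:
  "coord 0 x = 0" "coord (f + g) x = coord f x + coord g x" "coord (f - g) x = coord f x - coord g x"
  "coord (- f) x = - coord f x" "coord (c *\<^sub>R f) x = complex_of_real c * coord f x"
  by (simp_all add: zero_l2.rep_eq plus_l2.rep_eq minus_l2.rep_eq uminus_l2.rep_eq scaleR_l2.rep_eq)

lemma coord_sum [simp]: "coord (\<Sum>i\<in>I. f i) x = (\<Sum>i\<in>I. coord (f i) x)"
  by (induction I rule: infinite_finite_induct) auto

instantiation l2 :: (type) real_inner
begin

definition inner_l2 :: "'a l2 \<Rightarrow> 'a l2 \<Rightarrow> real" where
  "inner_l2 f g = (\<Sum>\<^sub>\<infinity>x. coord f x \<bullet> coord g x)"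
definition norm_l2 :: "'a l2 \<Rightarrow> real" where "norm_l2 f = sqrt (f \<bullet> f)"
definition dist_l2 :: "'a l2 \<Rightarrow> 'a l2 \<Rightarrow> real" where "dist_l2 f g = norm (f - g)"
definition sgn_l2 :: "'a l2 \<Rightarrow> 'a l2" where "sgn_l2 f = f /\<^sub>R norm f"
definition uniformity_l2 :: "('a l2 \<times> 'a l2) filter" where
  "uniformity_l2 = (INF e\<in>{0 <..}. principal {(x, y). dist x y < e})"
definition open_l2 :: "'a l2 set \<Rightarrow> bool" where
  "open_l2 S = (\<forall>x\<in>S. \<forall>\<^sub>F (x', y) in uniformity. x' = x \<longrightarrow> y \<in> S)"

instance
proof
  note summable = square_summable_inner[OF square_summable_coord square_summable_coord]
  fix f g h :: "'a l2" and c :: real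
  show "f \<bullet> g = g \<bullet> f"
    by (simp add: inner_l2_def inner_commute)
  show "(f + g) \<bullet> h = f \<bullet> h + g \<bullet> h"
    by (simp add: inner_l2_def inner_add_left infsum_add[OF summable summable])
  show "(c *\<^sub>R f) \<bullet> g = c * (f \<bullet> g)"
    by (simp add: inner_l2_def infsum_cmult_right[OF summable] flip: scaleR_conv_of_real)
  show "0 \<le> f \<bullet> f"
    by (simp add: inner_l2_def infsum_nonneg)
  show "(f \<bullet> f = 0) = (f = 0)"
  proof
    assume "f \<bullet> f = 0"
    then have "coord f x \<bullet> coord f x = 0" for x
      by (intro nonneg_infsum_le_0D[of "\<lambda>x. coord f x \<bullet> coord f x" UNIV])
         (auto simp: inner_l2_def summable)
    then show "f = 0" by (intro l2_eqI) simp
  qed (simp add: inner_l2_def)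
qed (simp_all only: norm_l2_def dist_l2_def sgn_l2_def uniformity_l2_def open_l2_def)

end

lemma norm_l2_sq: "(norm f)\<^sup>2 = (\<Sum>\<^sub>\<infinity>x. (cmod (coord f x))\<^sup>2)"
  by (simp add: dot_square_norm[symmetric] inner_l2_def)

lemma finite_sum_le_norm_sq:
  assumes "finite F"
  shows "(\<Sum>x\<in>F. (cmod (coord f x))\<^sup>2) \<le> (norm f)\<^sup>2"
  unfolding norm_l2_sq
  by (rule finite_sum_le_infsum) (use assms square_summable_coord[of f, unfolded square_summable_def] in auto)

lemma norm_l2_le:
  assumes "\<And>F. finite F \<Longrightarrow> (\<Sum>x\<in>F. (cmod (coord f x))\<^sup>2) \<le> C\<^sup>2" "0 \<le> C"
  shows "norm f \<le> C"
proof (rule power2_le_imp_le)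
  show "(norm f)\<^sup>2 \<le> C\<^sup>2"
    unfolding norm_l2_sq
    by (rule infsum_le_finite_sums)
       (use assms(1) square_summable_coord[of f, unfolded square_summable_def] in auto)
qed fact

lemma norm_coord_le: "cmod (coord f x) \<le> norm f"
  using finite_sum_le_norm_sq[of "{x}" f] by (auto intro: power2_le_imp_le)

instance l2 :: (type) complete_space
proof
  fix X :: "nat \<Rightarrow> 'a l2" assume X: "Cauchy X"
  have "Cauchy (\<lambda>n. coord (X n) x)" for x
  proof (rule metric_CauchyI)
    fix e :: real assume "0 < e"
    then obtain M where M: "\<And>m n. m \<ge> M \<Longrightarrow> n \<ge> M \<Longrightarrow> dist (X m) (X n) < e"
      using metric_CauchyD[OF X] by blast
    have "dist (coord (X m) x) (coord (X n) x) \<le> dist (X m) (X n)" for m n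
      using norm_coord_le[of "X m - X n" x] by (simp add: dist_norm)
    then show "\<exists>M. \<forall>m\<ge>M. \<forall>n\<ge>M. dist (coord (X m) x) (coord (X n) x) < e"
      by (intro exI[of _ M] allI impI) (rule le_less_trans[OF _ M])
  qed
  then have f: "(\<lambda>n. coord (X n) x) \<longlonglongrightarrow> lim (\<lambda>n. coord (X n) x)" for x
    by (simp add: Cauchy_convergent convergent_LIMSEQ_iff[symmetric])
  define f where "f x = lim (\<lambda>n. coord (X n) x)" for x
  note f = f[folded f_def]
  \<comment> \<open>The Cauchy estimate survives the coordinatewise limit on each finite set, with
    \<open>M\<close> independent of that set; this gives both summability of \<open>f\<close> and
    convergence in norm.\<close>
  have close: "\<exists>M. \<forall>n\<ge>M. \<forall>F. finite F \<longrightarrow> (\<Sum>x\<in>F. (cmod (coord (X n) x - f x))\<^sup>2) \<le> e\<^sup>2"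
    if e: "0 < e" for e
  proof -
    obtain M where M: "\<And>m n. m \<ge> M \<Longrightarrow> n \<ge> M \<Longrightarrow> dist (X m) (X n) < e"
      using metric_CauchyD[OF X e] by blast
    have "(\<Sum>x\<in>F. (cmod (coord (X n) x - f x))\<^sup>2) \<le> e\<^sup>2" if n: "n \<ge> M" and F: "finite F" for n F
    proof (rule LIMSEQ_le_const2)
      show "(\<lambda>m. \<Sum>x\<in>F. (cmod (coord (X n) x - coord (X m) x))\<^sup>2)
          \<longlonglongrightarrow> (\<Sum>x\<in>F. (cmod (coord (X n) x - f x))\<^sup>2)"
        by (intro tendsto_intros f)
      have "(\<Sum>x\<in>F. (cmod (coord (X n) x - coord (X m) x))\<^sup>2) \<le> e\<^sup>2" if m: "m \<ge> M" for m
      proof -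
        have "(\<Sum>x\<in>F. (cmod (coord (X n - X m) x))\<^sup>2) \<le> (norm (X n - X m))\<^sup>2"
          by (rule finite_sum_le_norm_sq[OF F])
        also have "\<dots> \<le> e\<^sup>2"
          using M[OF n m] by (intro power_mono) (auto simp: dist_norm)
        finally show ?thesis by simp
      qed
      then show "\<exists>M. \<forall>m\<ge>M. (\<Sum>x\<in>F. (cmod (coord (X n) x - coord (X m) x))\<^sup>2) \<le> e\<^sup>2" by blast
    qed
    then show ?thesis by blast
  qed
  have f_summable: "square_summable f"
  proof -
    obtain M where M: "\<And>F. finite F \<Longrightarrow> (\<Sum>x\<in>F. (cmod (coord (X M) x - f x))\<^sup>2) \<le> 1\<^sup>2"
      using close[OF zero_less_one] by blast
    have "square_summable (\<lambda>x. coord (X M) x - f x)"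
      by (rule square_summableI[OF M])
    from square_summable_diff[OF square_summable_coord[of "X M"] this] show ?thesis by simp
  qed
  have "X \<longlonglongrightarrow> Abs_l2 f"
  proof (rule metric_LIMSEQ_I)
    fix e :: real assume e: "0 < e"
    obtain M where M: "\<And>n F. n \<ge> M \<Longrightarrow> finite F \<Longrightarrow>
        (\<Sum>x\<in>F. (cmod (coord (X n) x - f x))\<^sup>2) \<le> (e / 2)\<^sup>2"
      using close[OF half_gt_zero[OF e]] by blast
    have "norm (X n - Abs_l2 f) \<le> e / 2" if "n \<ge> M" for n
      by (rule norm_l2_le) (use M[OF that] e in \<open>auto simp: coord_Abs_l2[OF f_summable]\<close>)
    then have "\<forall>n\<ge>M. dist (X n) (Abs_l2 f) < e"
      using e by (fastforce simp: dist_norm)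
    then show "\<exists>M. \<forall>n\<ge>M. dist (X n) (Abs_l2 f) < e" by blast
  qed
  then show "convergent X" by (auto simp: convergent_def)
qed

section \<open>Complex scalars, coordinate projections and basis vectors\<close>

lift_definition cmul :: "complex \<Rightarrow> 'a l2 \<Rightarrow> 'a l2" is "\<lambda>c f x. c * f x"
  by (rule square_summable_cmult)

lift_definition restr :: "'a set \<Rightarrow> 'a l2 \<Rightarrow> 'a l2" is "\<lambda>V f x. if x \<in> V then f x else 0"
  by (rule square_summable_restrict)

lift_definition basis :: "'a \<Rightarrow> 'a l2" is delta
proof (rule square_summableI)
  fix x :: 'a and F :: "'a set" assume F: "finite F"
  have "(\<Sum>y\<in>F. (cmod (delta x y))\<^sup>2) = (\<Sum>y\<in>F. if y = x then 1 else 0)"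
    by (rule sum.cong) (auto simp: delta_def)
  then show "(\<Sum>y\<in>F. (cmod (delta x y))\<^sup>2) \<le> 1"
    using F by simp
qed

lemma coord_cmul [simp]: "coord (cmul c f) x = c * coord f x"
  by (simp add: cmul.rep_eq)

lemma coord_restr [simp]: "coord (restr V f) x = (if x \<in> V then coord f x else 0)"
  by (simp add: restr.rep_eq)

lemma coord_basis [simp]: "coord (basis x) y = (if y = x then 1 else 0)"
  by (simp add: basis.rep_eq delta_def)

lemma bounded_linear_cmul: "bounded_linear (cmul c)"
proof (rule bounded_linear_intro[where K = "cmod c"])
  show "norm (cmul c f) \<le> norm f * cmod c" for f :: "'a l2"
  proof (rule norm_l2_le)
    fix F :: "'a set" assume "finite F"
    then have "(cmod c)\<^sup>2 * (\<Sum>x\<in>F. (cmod (coord f x))\<^sup>2) \<le> (cmod c)\<^sup>2 * (norm f)\<^sup>2"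
      by (intro mult_left_mono finite_sum_le_norm_sq) auto
    then show "(\<Sum>x\<in>F. (cmod (coord (cmul c f) x))\<^sup>2) \<le> (norm f * cmod c)\<^sup>2"
      by (simp add: norm_mult power_mult_distrib sum_distrib_left algebra_simps)
  qed simp
qed (auto intro!: l2_eqI simp: algebra_simps)

lemma norm_restr_le: "norm (restr V f) \<le> norm f"
proof (rule norm_l2_le)
  fix F :: "'a set" assume F: "finite F"
  have "(\<Sum>x\<in>F. (cmod (coord (restr V f) x))\<^sup>2) \<le> (\<Sum>x\<in>F. (cmod (coord f x))\<^sup>2)"
    by (rule sum_mono) auto
  also have "\<dots> \<le> (norm f)\<^sup>2" by (rule finite_sum_le_norm_sq[OF F])
  finally show "(\<Sum>x\<in>F. (cmod (coord (restr V f) x))\<^sup>2) \<le> (norm f)\<^sup>2" .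
qed simp

lemma bounded_linear_restr: "bounded_linear (restr V)"
  by (rule bounded_linear_intro[where K = 1]) (auto intro!: l2_eqI norm_restr_le)

lemma inner_basis: "f \<bullet> basis x = Re (coord f x)"
proof -
  have "f \<bullet> basis x = (\<Sum>\<^sub>\<infinity>y\<in>{x}. coord f y \<bullet> coord (basis x) y)"
    unfolding inner_l2_def by (rule infsum_cong_neutral) auto
  then show ?thesis by (simp add: inner_complex_def)
qed

lemma norm_basis: "norm (basis x) = 1"
  by (simp add: norm_eq_sqrt_inner inner_basis)

lemma inner_cmul_cancel: "cmul c f \<bullet> g = f \<bullet> cmul (cnj c) g"
  by (simp add: inner_l2_def inner_complex_eq mult_ac)

lemma inner_restr: "restr V f \<bullet> g = f \<bullet> restr V g"
  unfolding inner_l2_def by (rule infsum_cong) auto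

text \<open>The squared norm of the tail outside a finite \<open>F\<close> is at most
  \<open>(norm f)^2\<close> minus the partial sum over \<open>F\<close>, and that difference tends
  to 0.\<close>

lemma basis_expansion: "((\<lambda>x. cmul (coord f x) (basis x)) has_sum f) UNIV"
proof -
  let ?s = "\<lambda>F. \<Sum>x\<in>F. cmul (coord f x) (basis x)"
  have lim: "((\<lambda>F. (norm f)\<^sup>2 - (\<Sum>x\<in>F. (cmod (coord f x))\<^sup>2)) \<longlongrightarrow> (norm f)\<^sup>2 - (norm f)\<^sup>2)
      (finite_subsets_at_top UNIV)"
    unfolding norm_l2_sq
    by (intro tendsto_intros infsum_tendsto square_summable_coord[unfolded square_summable_def])
  have coord_s: "coord (?s F) y = (if y \<in> F then coord f y else 0)" if "finite F" for F y
    using that by (simp add: if_distrib[of "\<lambda>c. _ * c"] cong: if_cong)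
  have norm_s: "norm (?s F - f) \<le> sqrt ((norm f)\<^sup>2 - (\<Sum>x\<in>F. (cmod (coord f x))\<^sup>2))"
    if F: "finite F" for F
  proof (rule norm_l2_le)
    fix E :: "'a set" assume E: "finite E"
    have "(\<Sum>x\<in>E. (cmod (coord (?s F - f) x))\<^sup>2) = (\<Sum>x\<in>E. if x \<in> F then 0 else (cmod (coord f x))\<^sup>2)"
      unfolding coord_simps coord_s[OF F] by (rule sum.cong) auto
    also have "\<dots> = (\<Sum>x\<in>E - F. (cmod (coord f x))\<^sup>2)"
      using E by (intro sum.mono_neutral_cong_right) auto
    also have "\<dots> = (\<Sum>x\<in>E \<union> F. (cmod (coord f x))\<^sup>2) - (\<Sum>x\<in>F. (cmod (coord f x))\<^sup>2)"
      using E F sum.union_disjoint[of "E - F" F "\<lambda>x. (cmod (coord f x))\<^sup>2"]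
      by (simp add: Int_commute)
    also have "\<dots> \<le> (norm f)\<^sup>2 - (\<Sum>x\<in>F. (cmod (coord f x))\<^sup>2)"
      using E F by (intro diff_right_mono finite_sum_le_norm_sq) auto
    finally show "(\<Sum>x\<in>E. (cmod (coord (?s F - f) x))\<^sup>2) \<le>
        (sqrt ((norm f)\<^sup>2 - (\<Sum>x\<in>F. (cmod (coord f x))\<^sup>2)))\<^sup>2"
      using finite_sum_le_norm_sq[OF F, of f] by simp
  qed (use finite_sum_le_norm_sq[OF F, of f] in simp)
  have "((\<lambda>F. ?s F - f) \<longlongrightarrow> 0) (finite_subsets_at_top UNIV)"
  proof (rule Lim_null_comparison)
    show "\<forall>\<^sub>F F in finite_subsets_at_top UNIV.
        norm (?s F - f) \<le> sqrt ((norm f)\<^sup>2 - (\<Sum>x\<in>F. (cmod (coord f x))\<^sup>2))"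
      using norm_s by (auto intro: eventually_finite_subsets_at_top_weakI)
    show "((\<lambda>F. sqrt ((norm f)\<^sup>2 - (\<Sum>x\<in>F. (cmod (coord f x))\<^sup>2))) \<longlongrightarrow> 0)
        (finite_subsets_at_top UNIV)"
      using tendsto_real_sqrt[OF lim] by simp
  qed
  then show ?thesis by (simp add: has_sum_def LIM_zero_iff)
qed

text \<open>The maps are only real linear, so agreement is required on all complex multiples of
  basis vectors; the expansion then does the rest by continuity.\<close>

lemma bounded_linear_eq_on_basis:
  fixes S T :: "'a l2 \<Rightarrow> 'b::real_normed_vector"
  assumes "bounded_linear S" "bounded_linear T"
    and "\<And>x c. S (cmul c (basis x)) = T (cmul c (basis x))"
  shows "S f = T f"
  using has_sum_bounded_linear[OF assms(1) basis_expansion[of f]]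
    has_sum_bounded_linear[OF assms(2) basis_expansion[of f]]
  by (simp add: assms(3) has_sum_unique)

section \<open>Operators on a set of vertices\<close>

lemma ell2_square_summable:
  assumes "f \<in> ell2 V"
  shows "square_summable f"
proof -
  have "(\<lambda>x. (cmod (f x))\<^sup>2) summable_on UNIV \<longleftrightarrow> (\<lambda>x. (cmod (f x))\<^sup>2) summable_on V"
    using assms by (intro summable_on_cong_neutral) (auto simp: ell2_def)
  then show ?thesis using assms by (simp add: square_summable_def ell2_def)
qed

lemma ell2_vanish: "f \<in> ell2 V \<Longrightarrow> x \<notin> V \<Longrightarrow> f x = 0"
  by (simp add: ell2_def)

lemma coord_Abs_l2_ell2 [simp]: "f \<in> ell2 V \<Longrightarrow> coord (Abs_l2 f) = f"
  by (intro coord_Abs_l2 ell2_square_summable)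

lemma coord_in_ell2_iff: "coord h \<in> ell2 V \<longleftrightarrow> restr V h = h"
proof
  assume "coord h \<in> ell2 V"
  then show "restr V h = h" by (intro l2_eqI) (simp add: ell2_def)
next
  assume h: "restr V h = h"
  have "coord h x = 0" if "x \<notin> V" for x
    using that by (subst h[symmetric]) simp
  moreover have "(\<lambda>x. (cmod (coord h x))\<^sup>2) summable_on V"
    using square_summable_coord[of h] unfolding square_summable_def
    by (rule summable_on_subset) simp
  ultimately show "coord h \<in> ell2 V" by (simp add: ell2_def)
qed

lemma restr_restr [simp]: "restr V (restr V h) = restr V h"
  by (intro l2_eqI) simp

lemma coord_restr_in_ell2: "coord (restr V h) \<in> ell2 V"
  by (simp add: coord_in_ell2_iff)

lemma restr_Abs_l2: "f \<in> ell2 V \<Longrightarrow> restr V (Abs_l2 f) = Abs_l2 f"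
  by (subst coord_in_ell2_iff[symmetric]) simp

text \<open>Pairing with \<open>cmul \<i> g\<close> turns the imaginary part into a real part.
  Support of one factor in \<open>V\<close> already reduces the sum over the type to a sum over
  \<open>V\<close>.\<close>

lemma l2_inner_coord:
  assumes "restr V f = f"
  shows "l2_inner V (coord f) (coord g) = Complex (f \<bullet> g) (f \<bullet> cmul \<i> g)"
proof -
  let ?h = "\<lambda>x. coord f x * cnj (coord g x)"
  have s: "?h summable_on UNIV"
    by (intro square_summable_mult square_summable_coord)
  have "l2_inner V (coord f) (coord g) = infsum ?h UNIV"
    unfolding l2_inner_def using assms[folded coord_in_ell2_iff]
    by (intro infsum_cong_neutral) (auto simp: ell2_def)
  moreover have "Re (infsum ?h UNIV) = f \<bullet> g"
    by (simp add: inner_l2_def inner_complex_eq infsum_Re[OF s, symmetric])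
  moreover have "Im (infsum ?h UNIV) = f \<bullet> cmul \<i> g"
    by (simp add: inner_l2_def inner_complex_def infsum_Im[OF s, symmetric] algebra_simps)
  ultimately show ?thesis by (simp add: complex_eq_iff)
qed

lemma l2_norm_coord:
  assumes "restr V f = f"
  shows "l2_norm V (coord f) = norm f"
proof -
  have "(\<Sum>\<^sub>\<infinity>x\<in>V. (cmod (coord f x))\<^sup>2) = (norm f)\<^sup>2"
    unfolding norm_l2_sq using assms[folded coord_in_ell2_iff]
    by (intro infsum_cong_neutral) (auto simp: ell2_def)
  then show ?thesis by (simp add: l2_norm_def)
qed

lemma Abs_l2_add: "f \<in> ell2 V \<Longrightarrow> g \<in> ell2 V \<Longrightarrow> Abs_l2 (\<lambda>x. f x + g x) = Abs_l2 f + Abs_l2 g"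
  by (intro l2_eqI)
     (simp add: coord_Abs_l2[OF square_summable_add[OF ell2_square_summable ell2_square_summable]])

lemma Abs_l2_cmult: "f \<in> ell2 V \<Longrightarrow> Abs_l2 (\<lambda>x. c * f x) = cmul c (Abs_l2 f)"
  by (intro l2_eqI) (simp add: coord_Abs_l2[OF square_summable_cmult[OF ell2_square_summable]])

lemma cmul_of_real: "cmul (complex_of_real c) f = c *\<^sub>R f"
  by (intro l2_eqI) simp

section \<open>Transport of operators between \<open>ell2 V\<close> and the whole space\<close>

definition extend_op :: "'a set \<Rightarrow> 'a operator \<Rightarrow> 'a l2 \<Rightarrow> 'a l2" where
  "extend_op V T h = Abs_l2 (T (coord (restr V h)))"

text \<open>\<open>restrict\<close> supplies the fixed value outside \<open>ell2 V\<close> that the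
  extensional function space in \<open>bounded_operator\<close> demands.\<close>

definition restrict_op :: "'a set \<Rightarrow> ('a l2 \<Rightarrow> 'a l2) \<Rightarrow> 'a operator" where
  "restrict_op V L = restrict (\<lambda>f. coord (L (Abs_l2 f))) (ell2 V)"

lemma restrict_op_apply: "f \<in> ell2 V \<Longrightarrow> restrict_op V L f = coord (L (Abs_l2 f))"
  by (simp add: restrict_op_def)

context
  fixes V :: "'a set" and T :: "'a operator"
  assumes T: "bounded_operator V T"
begin

lemma bounded_operator_in_ell2: "f \<in> ell2 V \<Longrightarrow> T f \<in> ell2 V"
  using T by (auto simp: bounded_operator_def)

lemma bounded_operator_add:
  "f \<in> ell2 V \<Longrightarrow> g \<in> ell2 V \<Longrightarrow> T (\<lambda>x. f x + g x) = (\<lambda>x. T f x + T g x)"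
  using T by (simp add: bounded_operator_def)

lemma bounded_operator_cmult: "f \<in> ell2 V \<Longrightarrow> T (\<lambda>x. c * f x) = (\<lambda>x. c * T f x)"
  using T by (simp add: bounded_operator_def)

lemma coord_extend_op: "coord (extend_op V T h) = T (coord (restr V h))"
  unfolding extend_op_def
  by (rule coord_Abs_l2_ell2[OF bounded_operator_in_ell2[OF coord_restr_in_ell2]])

lemma restr_extend_op: "restr V (extend_op V T h) = extend_op V T h"
  unfolding extend_op_def
  by (rule restr_Abs_l2[OF bounded_operator_in_ell2[OF coord_restr_in_ell2]])

lemma extend_op_restr: "extend_op V T (restr V h) = extend_op V T h"
  by (simp add: extend_op_def)

lemma extend_op_cmul: "extend_op V T (cmul c h) = cmul c (extend_op V T h)"
proof -
  have "coord (restr V (cmul c h)) = (\<lambda>x. c * coord (restr V h) x)" by auto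
  from arg_cong[OF this, of T, unfolded bounded_operator_cmult[OF coord_restr_in_ell2]]
  show ?thesis by (intro l2_eqI) (simp add: coord_extend_op)
qed

lemma bounded_linear_extend_op: "bounded_linear (extend_op V T)"
proof -
  obtain C where C: "\<And>f. f \<in> ell2 V \<Longrightarrow> l2_norm V (T f) \<le> C * l2_norm V f"
    using T unfolding bounded_operator_def by blast
  show ?thesis
  proof (rule bounded_linear_intro[where K = "\<bar>C\<bar>"])
    fix f g :: "'a l2" and c :: real
    have "coord (restr V (f + g)) = (\<lambda>x. coord (restr V f) x + coord (restr V g) x)" by auto
    from arg_cong[OF this, of T,
        unfolded bounded_operator_add[OF coord_restr_in_ell2 coord_restr_in_ell2]]
    show "extend_op V T (f + g) = extend_op V T f + extend_op V T g"
      by (intro l2_eqI) (simp add: coord_extend_op)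
    show "extend_op V T (c *\<^sub>R f) = c *\<^sub>R extend_op V T f"
      by (simp add: extend_op_cmul flip: cmul_of_real)
    have "norm (extend_op V T f) = l2_norm V (T (coord (restr V f)))"
      by (simp add: l2_norm_coord[OF restr_extend_op, symmetric] coord_extend_op)
    also have "\<dots> \<le> C * norm (restr V f)"
      using C[OF coord_restr_in_ell2] by (simp add: l2_norm_coord)
    also have "\<dots> \<le> \<bar>C\<bar> * norm (restr V f)"
      by (intro mult_right_mono) auto
    also have "\<dots> \<le> \<bar>C\<bar> * norm f"
      by (intro mult_left_mono norm_restr_le) auto
    finally show "norm (extend_op V T f) \<le> norm f * \<bar>C\<bar>" by (simp add: mult.commute)
  qed
qed

lemma restrict_extend_op: "restrict_op V (extend_op V T) = T"
proof
  fix f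
  show "restrict_op V (extend_op V T) f = T f"
  proof (cases "f \<in> ell2 V")
    case True
    then show ?thesis by (simp add: restrict_op_apply coord_extend_op restr_Abs_l2)
  next
    case False
    then show ?thesis
      using T by (auto simp: restrict_op_def bounded_operator_def PiE_def extensional_def)
  qed
qed

end

locale operator_on =
  fixes V :: "'a set" and L :: "'a l2 \<Rightarrow> 'a l2"
  assumes bounded_linear: "bounded_linear L"
    and cmul: "L (cmul c f) = cmul c (L f)"
    and supported: "restr V f = f \<Longrightarrow> restr V (L f) = L f"
begin

lemma restrict_op_in_ell2: "f \<in> ell2 V \<Longrightarrow> restrict_op V L f \<in> ell2 V"
  by (simp add: restrict_op_apply coord_in_ell2_iff supported restr_Abs_l2)

lemma Abs_l2_restrict_op: "f \<in> ell2 V \<Longrightarrow> Abs_l2 (restrict_op V L f) = L (Abs_l2 f)"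
  by (simp add: restrict_op_apply coord_inverse)

lemma bounded_operator_restrict_op: "bounded_operator V (restrict_op V L)"
proof -
  obtain K where K: "\<And>f. norm (L f) \<le> norm f * K"
    using bounded_linear.bounded[OF bounded_linear] by blast
  have "l2_norm V (restrict_op V L f) \<le> K * l2_norm V f" if f: "f \<in> ell2 V" for f
    using l2_norm_coord[OF supported[OF restr_Abs_l2[OF f]]] l2_norm_coord[OF restr_Abs_l2[OF f]]
      K[of "Abs_l2 f"] f
    by (simp add: restrict_op_apply mult.commute)
  moreover have "restrict_op V L (\<lambda>x. f x + g x) = (\<lambda>x. restrict_op V L f x + restrict_op V L g x)"
    if fg: "f \<in> ell2 V" "g \<in> ell2 V" for f g
  proof -
    have "(\<lambda>x. f x + g x) \<in> ell2 V"
      using coord_in_ell2_iff[of "Abs_l2 f + Abs_l2 g" V] fg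
      by (auto simp: fun_eq_iff ell2_vanish Abs_l2_add[symmetric] restr_Abs_l2
        coord_Abs_l2[OF square_summable_add[OF ell2_square_summable ell2_square_summable]]
        intro!: l2_eqI)
    then show ?thesis
      using fg by (auto simp: restrict_op_apply Abs_l2_add linear_add[OF bounded_linear.linear[OF bounded_linear]])
  qed
  moreover have "restrict_op V L (\<lambda>x. c * f x) = (\<lambda>x. c * restrict_op V L f x)"
    if f: "f \<in> ell2 V" for c f
  proof -
    have "(\<lambda>x. c * f x) \<in> ell2 V"
      using f square_summable_cmult[OF ell2_square_summable[OF f]]
      by (auto simp: ell2_def square_summable_def intro: summable_on_subset)
    then show ?thesis
      using f by (auto simp: restrict_op_apply Abs_l2_cmult cmul)
  qed
  moreover have "restrict_op V L \<in> ell2 V \<rightarrow>\<^sub>E ell2 V"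
    using restrict_op_in_ell2 by (auto simp: restrict_op_def)
  ultimately show ?thesis unfolding bounded_operator_def by blast
qed

lemma l2_inner_restrict_op_left:
  assumes "f \<in> ell2 V" "g \<in> ell2 V"
  shows "l2_inner V (restrict_op V L f) g =
    Complex (L (Abs_l2 f) \<bullet> Abs_l2 g) (L (Abs_l2 f) \<bullet> cmul \<i> (Abs_l2 g))"
  using l2_inner_coord[of V "L (Abs_l2 f)" "Abs_l2 g"] assms
  by (simp add: supported restr_Abs_l2 restrict_op_apply)

lemma l2_inner_restrict_op_right:
  assumes "f \<in> ell2 V" "g \<in> ell2 V"
  shows "l2_inner V f (restrict_op V L g) =
    Complex (Abs_l2 f \<bullet> L (Abs_l2 g)) (Abs_l2 f \<bullet> L (cmul \<i> (Abs_l2 g)))"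
  using l2_inner_coord[of V "Abs_l2 f" "L (Abs_l2 g)"] assms
  by (simp add: restr_Abs_l2 restrict_op_apply cmul)

lemma compose_restrict_op:
  "compose (ell2 V) (restrict_op V L) (restrict_op V L) = restrict_op V (\<lambda>f. L (L f))"
proof
  fix f
  show "compose (ell2 V) (restrict_op V L) (restrict_op V L) f = restrict_op V (\<lambda>f. L (L f)) f"
  proof (cases "f \<in> ell2 V")
    case True
    then show ?thesis
      using restrict_op_in_ell2[OF True]
      by (simp add: compose_eq restrict_op_apply[of "restrict_op V L f"] Abs_l2_restrict_op
          restrict_op_apply[of f V "\<lambda>f. L (L f)"])
  next
    case False
    then show ?thesis by (simp add: compose_def restrict_op_def)
  qed
qed

lemma adjoint_restrict_op:
  assumes sym: "symmetric_op L"
  shows "adjoint_operator V (restrict_op V L) = restrict_op V L"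
  unfolding adjoint_operator_def
proof (rule the_equality)
  have adj: "l2_inner V (restrict_op V L f) g = l2_inner V f (restrict_op V L g)"
    if "f \<in> ell2 V" "g \<in> ell2 V" for f g
    using that by (simp add: l2_inner_restrict_op_left l2_inner_restrict_op_right symmetric_opD[OF sym])
  then show "bounded_operator V (restrict_op V L) \<and> (\<forall>f\<in>ell2 V. \<forall>g\<in>ell2 V.
      l2_inner V (restrict_op V L f) g = l2_inner V f (restrict_op V L g))"
    using bounded_operator_restrict_op by blast
  fix S assume S: "bounded_operator V S \<and> (\<forall>f\<in>ell2 V. \<forall>g\<in>ell2 V.
      l2_inner V (restrict_op V L f) g = l2_inner V f (S g))"
  \<comment> \<open>Pairing with \<open>delta x\<close> reads off the conjugate of the coordinate at
    \<open>x\<close>, so the adjoint identity determines \<open>S g\<close> on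
    \<open>V\<close>.\<close>
  have delta: "l2_inner V (delta x) h = cnj (h x)" if "x \<in> V" for x h
  proof -
    have "l2_inner V (delta x) h = (\<Sum>\<^sub>\<infinity>y\<in>{x}. delta x y * cnj (h y))"
      unfolding l2_inner_def using that by (intro infsum_cong_neutral) (auto simp: delta_def)
    then show ?thesis by (simp add: delta_def)
  qed
  have "S g x = restrict_op V L g x" if g: "g \<in> ell2 V" for g x
  proof (cases "x \<in> V")
    case True
    have "delta x \<in> ell2 V"
      using coord_in_ell2_iff[of "basis x" V] True by (auto simp: basis.rep_eq delta_def intro!: l2_eqI)
    then have "l2_inner V (delta x) (S g) = l2_inner V (delta x) (restrict_op V L g)"
      using S adj g by metis
    then show ?thesis by (simp add: delta[OF True])
  next
    case False
    have "S g \<in> ell2 V" using S g bounded_operator_in_ell2 by blast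
    then show ?thesis using False restrict_op_in_ell2[OF g] by (simp add: ell2_vanish)
  qed
  moreover have "S g = restrict_op V L g" if "g \<notin> ell2 V" for g
    using S that by (auto simp: restrict_op_def bounded_operator_def PiE_def extensional_def)
  ultimately show "S = restrict_op V L" by (metis ext)
qed

end

section \<open>Positive operators and the absolute value\<close>

lemma extend_positive_operator:
  assumes S: "positive_operator V S"
  shows "symmetric_op (extend_op V S)" "0 \<le> extend_op V S h \<bullet> h"
proof -
  let ?L = "extend_op V S"
  have b: "bounded_operator V S" using S by (simp add: positive_operator_def)
  note lin = bounded_linear.linear[OF bounded_linear_extend_op[OF b]]
  have "l2_inner V (coord (?L h)) (coord (restr V h)) \<in> \<real>\<^sub>\<ge>\<^sub>0" for h
    using S coord_restr_in_ell2[of V h] by (simp add: coord_extend_op[OF b] positive_operator_def)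
  moreover have "restr V (cmul c h) = cmul c (restr V h)" for c h
    by (intro l2_eqI) simp
  ultimately have form: "0 \<le> ?L h \<bullet> h \<and> ?L h \<bullet> cmul \<i> h = 0" for h
    unfolding l2_inner_coord[OF restr_extend_op[OF b]]
    by (metis complex_nonneg_Reals_iff complex.sel inner_restr restr_extend_op[OF b])
  then show "0 \<le> ?L h \<bullet> h" by blast
  have "?L f \<bullet> g = f \<bullet> ?L g" for f g
  proof -
    \<comment> \<open>Polarization: the imaginary part of the form vanishes at \<open>f\<close>, at
      \<open>g\<close> and at \<open>f + \<i> g\<close>; expanding the last leaves exactly the
      symmetry of \<open>?L\<close>.\<close>
    have "?L (f + cmul \<i> g) \<bullet> cmul \<i> (f + cmul \<i> g) = 0" using form by blast
    moreover have "cmul \<i> (f + cmul \<i> g) = cmul \<i> f - g"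
      by (intro l2_eqI) (simp add: algebra_simps)
    moreover have "cmul \<i> (?L g) \<bullet> cmul \<i> f = ?L g \<bullet> f"
    proof -
      have "cmul (cnj \<i>) (cmul \<i> f) = f" by (intro l2_eqI) simp
      then show ?thesis by (simp add: inner_cmul_cancel)
    qed
    moreover have "cmul \<i> (?L g) \<bullet> g = - (?L g \<bullet> cmul \<i> g)"
    proof -
      have "cmul (cnj \<i>) g = - cmul \<i> g" by (intro l2_eqI) simp
      then show ?thesis by (simp add: inner_cmul_cancel)
    qed
    ultimately show ?thesis
      using form[of f] form[of g]
      by (simp add: linear_add[OF lin] extend_op_cmul[OF b] inner_add_left inner_diff_right
          inner_commute algebra_simps)
  qed
  then show "symmetric_op ?L" by (simp add: symmetric_op_def)
qed

text \<open>The modulus commutes with complex scalars and with \<open>restr V\<close> because the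
  square of \<open>A\<close> does, so it descends to \<open>ell2 V\<close>. For uniqueness, a
  positive root on \<open>ell2 V\<close> is extended by zero and \<open>modulus_unique\<close>
  applies.\<close>

lemma abs_operator_restrict_op:
  assumes A: "bounded_symmetric A N" and cmul: "\<And>c f. A (cmul c f) = cmul c (A f)"
    and supp: "\<And>f. restr V (A f) = A f" "\<And>f. A (restr V f) = A f"
  shows "abs_operator V (restrict_op V A) = restrict_op V (bounded_symmetric.modulus A N)"
    and "operator_on V (bounded_symmetric.modulus A N)"
    and "bounded_symmetric.modulus A N f \<bullet> cmul \<i> f = 0"
proof -
  interpret bounded_symmetric A N by (rule A)
  interpret A: operator_on V A
    by (rule operator_on.intro) (simp_all add: bounded_linear cmul supp)
  have comm_cmul: "modulus (cmul c f) = cmul c (modulus f)" for c f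
    by (rule modulus_commute[symmetric, OF bounded_linear_cmul]) (simp add: cmul)
  have comm_restr: "restr V (modulus f) = modulus (restr V f)" for f
    by (rule modulus_commute[OF bounded_linear_restr]) (simp add: supp)
  show op: "operator_on V modulus"
    by (rule operator_on.intro) (simp_all add: bounded_linear_modulus comm_cmul comm_restr)
  interpret M: operator_on V modulus by (rule op)
  show im: "modulus f \<bullet> cmul \<i> f = 0" for f
  proof -
    \<comment> \<open>Symmetry and the skewness of multiplication by \<open>\<i>\<close> make this
      number equal to its own negative.\<close>
    have "modulus f \<bullet> cmul \<i> f = f \<bullet> cmul \<i> (modulus f)"
      by (simp add: symmetric_opD[OF symmetric_modulus] comm_cmul)
    also have "\<dots> = - (modulus f \<bullet> cmul \<i> f)"
    proof -
      have "cmul (cnj \<i>) f = - cmul \<i> f" by (intro l2_eqI) simp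
      then show ?thesis by (simp add: inner_commute[of f] inner_cmul_cancel)
    qed
    finally show ?thesis by simp
  qed
  have "positive_operator V (restrict_op V modulus)"
    using im modulus_pos M.bounded_operator_restrict_op
    by (auto simp: positive_operator_def M.l2_inner_restrict_op_left complex_nonneg_Reals_iff)
  moreover have "compose (ell2 V) (restrict_op V modulus) (restrict_op V modulus) =
      restrict_op V (\<lambda>f. A (A f))"
    by (simp add: M.compose_restrict_op modulus_modulus)
  moreover have "S = restrict_op V modulus"
    if S: "positive_operator V S" "compose (ell2 V) S S = restrict_op V (\<lambda>f. A (A f))" for S
  proof -
    have b: "bounded_operator V S" using S by (simp add: positive_operator_def)
    have "extend_op V S (extend_op V S h) = A (A h)" for h
    proof -
      have "coord (extend_op V S (extend_op V S h)) = S (S (coord (restr V h)))"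
        by (simp add: coord_extend_op[OF b] restr_extend_op[OF b])
      also have "\<dots> = compose (ell2 V) S S (coord (restr V h))"
        by (simp add: compose_eq coord_restr_in_ell2)
      also have "\<dots> = coord (A (A h))"
        by (simp add: S(2) restrict_op_apply coord_restr_in_ell2 coord_inverse supp)
      finally show ?thesis by (simp add: coord_inject)
    qed
    then have "extend_op V S = modulus"
      by (intro modulus_unique bounded_linear_extend_op[OF b] extend_positive_operator[OF S(1)])
    then show ?thesis using restrict_extend_op[OF b] by simp
  qed
  ultimately have "sqrt_operator V (restrict_op V (\<lambda>f. A (A f))) = restrict_op V modulus"
    unfolding sqrt_operator_def by (intro the_equality) blast+
  then show "abs_operator V (restrict_op V A) = restrict_op V modulus"
    by (simp add: abs_operator_def A.adjoint_restrict_op[OF symmetric] A.compose_restrict_op)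
qed

section \<open>Adjacency operators and rooted balls\<close>

locale bounded_degree_graph =
  fixes G :: "'a ugraph" and D :: nat
  assumes simple: "simple_graph G"
    and finite_neighbours_verts: "x \<in> verts G \<Longrightarrow> finite (neighbours G x)"
    and card_neighbours_verts: "x \<in> verts G \<Longrightarrow> card (neighbours G x) \<le> D"
begin

lemma adj_verts: "adj G x y \<Longrightarrow> x \<in> verts G \<and> y \<in> verts G"
  using simple by (auto simp: adj_def simple_graph_def)

lemma adj_commute: "adj G x y \<longleftrightarrow> adj G y x"
  by (simp add: adj_def insert_commute)

lemma neighbours_outside: "x \<notin> verts G \<Longrightarrow> neighbours G x = {}"
  using adj_verts by (auto simp: neighbours_def)

lemma finite_neighbours: "finite (neighbours G x)"
  using finite_neighbours_verts[of x] neighbours_outside[of x] by (cases "x \<in> verts G") auto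

lemma card_neighbours: "card (neighbours G x) \<le> D"
  using card_neighbours_verts[of x] neighbours_outside[of x] by (cases "x \<in> verts G") auto

lemma neighbours_commute: "x \<in> neighbours G y \<longleftrightarrow> y \<in> neighbours G x"
  by (simp add: neighbours_def adj_commute)

lemma neighbours_subset: "neighbours G x \<subseteq> verts G"
  using adj_verts by (auto simp: neighbours_def)

text \<open>Cauchy-Schwarz over each neighbourhood costs a factor \<open>D\<close>. Exchanging the
  sums costs another, since each \<open>x\<close> is a neighbour of at most \<open>D\<close>
  vertices.\<close>

lemma neighbour_sum_bound:
  assumes F: "finite F"
  shows "(\<Sum>y\<in>F. (cmod (\<Sum>x\<in>neighbours G y. coord f x))\<^sup>2) \<le> (real D * norm f)\<^sup>2"
proof -
  \<comment> \<open>A finite range containing every vertex that occurs, so that the double sum can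
    be exchanged.\<close>
  define X where "X = (\<Union>y\<in>F. neighbours G y)"
  have X: "finite X" using F finite_neighbours by (auto simp: X_def)
  have "(cmod (\<Sum>x\<in>neighbours G y. coord f x))\<^sup>2 \<le> D * (\<Sum>x\<in>neighbours G y. (cmod (coord f x))\<^sup>2)" for y
  proof -
    have "(cmod (\<Sum>x\<in>neighbours G y. coord f x))\<^sup>2 \<le> (\<Sum>x\<in>neighbours G y. cmod (coord f x))\<^sup>2"
      by (intro power_mono norm_sum) auto
    also have "\<dots> \<le> (\<Sum>x\<in>neighbours G y. (cmod (coord f x))\<^sup>2) * card (neighbours G y)"
      by (rule sum_squared_le_sum_of_squares)
    also have "\<dots> \<le> (\<Sum>x\<in>neighbours G y. (cmod (coord f x))\<^sup>2) * D"
      using card_neighbours[of y] by (intro mult_left_mono sum_nonneg) auto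
    finally show ?thesis by (simp add: mult.commute)
  qed
  then have "(\<Sum>y\<in>F. (cmod (\<Sum>x\<in>neighbours G y. coord f x))\<^sup>2) \<le>
      D * (\<Sum>y\<in>F. \<Sum>x\<in>neighbours G y. (cmod (coord f x))\<^sup>2)"
    by (simp add: sum_distrib_left sum_mono)
  also have "(\<Sum>y\<in>F. \<Sum>x\<in>neighbours G y. (cmod (coord f x))\<^sup>2) =
      (\<Sum>y\<in>F. \<Sum>x | x \<in> X \<and> x \<in> neighbours G y. (cmod (coord f x))\<^sup>2)"
    by (intro sum.cong) (auto simp: X_def)
  also have "\<dots> = (\<Sum>x\<in>X. \<Sum>y | y \<in> F \<and> x \<in> neighbours G y. (cmod (coord f x))\<^sup>2)"
    by (rule sum.swap_restrict[OF F X])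
  also have "\<dots> \<le> (\<Sum>x\<in>X. D * (cmod (coord f x))\<^sup>2)"
  proof (rule sum_mono)
    fix x
    have "card {y \<in> F. x \<in> neighbours G y} \<le> card (neighbours G x)"
      by (rule card_mono[OF finite_neighbours]) (auto simp: neighbours_commute)
    then have "card {y \<in> F. x \<in> neighbours G y} \<le> D"
      using card_neighbours[of x] by simp
    then show "(\<Sum>y | y \<in> F \<and> x \<in> neighbours G y. (cmod (coord f x))\<^sup>2) \<le> D * (cmod (coord f x))\<^sup>2"
      by (simp add: mult_right_mono)
  qed
  also have "\<dots> \<le> D * (norm f)\<^sup>2"
    unfolding sum_distrib_left[symmetric] by (intro mult_left_mono finite_sum_le_norm_sq X) auto
  finally have "(\<Sum>y\<in>F. (cmod (\<Sum>x\<in>neighbours G y. coord f x))\<^sup>2) \<le> D * (D * (norm f)\<^sup>2)"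
    by (simp add: mult_left_mono)
  then show ?thesis by (simp add: power2_eq_square mult_ac)
qed

definition adj_op :: "'a l2 \<Rightarrow> 'a l2" where
  "adj_op f = Abs_l2 (\<lambda>y. \<Sum>x\<in>neighbours G y. coord f x)"

lemma coord_adj_op: "coord (adj_op f) y = (\<Sum>x\<in>neighbours G y. coord f x)"
  unfolding adj_op_def by (simp add: coord_Abs_l2[OF square_summableI[OF neighbour_sum_bound]])

text \<open>The summand 1 keeps the bound positive for \<open>D = 0\<close>, as
  \<open>bounded_symmetric\<close> requires.\<close>

lemma norm_adj_op_le: "norm (adj_op f) \<le> (real D + 1) * norm f"
proof -
  have "norm (adj_op f) \<le> real D * norm f"
    by (rule norm_l2_le) (simp_all add: coord_adj_op neighbour_sum_bound)
  then show ?thesis by (simp add: distrib_right add_increasing2)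
qed

lemma adj_op_cmul: "adj_op (cmul c f) = cmul c (adj_op f)"
  by (intro l2_eqI) (simp add: coord_adj_op sum_distrib_left)

lemma linear_adj_op: "linear adj_op"
  by (rule linearI; intro l2_eqI) (simp_all add: coord_adj_op sum.distrib sum_distrib_left)

lemma bounded_linear_adj_op: "bounded_linear adj_op"
  using norm_adj_op_le
  by (intro bounded_linear_intro[where K = "real D + 1"])
     (simp_all add: linear_add[OF linear_adj_op] linear_scale[OF linear_adj_op] mult.commute)

lemma adj_op_restr: "adj_op (restr (verts G) f) = adj_op f"
  by (intro l2_eqI) (use neighbours_subset in \<open>fastforce simp: coord_adj_op intro: sum.cong\<close>)

lemma restr_adj_op: "restr (verts G) (adj_op f) = adj_op f"
  by (intro l2_eqI) (simp add: coord_adj_op neighbours_outside)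

lemma adj_op_basis: "adj_op (basis x) = (\<Sum>y\<in>neighbours G x. basis y)"
proof (rule l2_eqI)
  fix z
  have "coord (adj_op (basis x)) z = (if x \<in> neighbours G z then 1 else 0)"
    by (simp add: coord_adj_op finite_neighbours)
  also have "\<dots> = coord (\<Sum>y\<in>neighbours G x. basis y) z"
    by (simp add: finite_neighbours neighbours_commute[of x z])
  finally show "coord (adj_op (basis x)) z = coord (\<Sum>y\<in>neighbours G x. basis y) z" .
qed

text \<open>Both sides are bounded and real linear in \<open>f\<close>, so multiples of basis
  vectors suffice; there both reduce to the same finite sum over neighbours.\<close>

lemma symmetric_adj_op: "symmetric_op adj_op"
proof -
  have "adj_op f \<bullet> g = f \<bullet> adj_op g" for f g
  proof (rule bounded_linear_eq_on_basis[of "\<lambda>f. adj_op f \<bullet> g" "\<lambda>f. f \<bullet> adj_op g"])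
    show "bounded_linear (\<lambda>f. adj_op f \<bullet> g)" "bounded_linear (\<lambda>f. f \<bullet> adj_op g)"
      by (rule bounded_linear_compose[OF bounded_linear_inner_left bounded_linear_adj_op],
          rule bounded_linear_inner_left)
    show "adj_op (cmul c (basis x)) \<bullet> g = cmul c (basis x) \<bullet> adj_op g" for x c
    proof -
      have "adj_op (cmul c (basis x)) \<bullet> g = adj_op (basis x) \<bullet> cmul (cnj c) g"
        by (simp add: adj_op_cmul inner_cmul_cancel)
      also have "\<dots> = (\<Sum>y\<in>neighbours G x. Re (cnj c * coord g y))"
        by (simp only: adj_op_basis inner_sum_left inner_commute[of "basis _"] inner_basis coord_cmul)
      also have "\<dots> = Re (coord (cmul (cnj c) (adj_op g)) x)"
        by (simp only: coord_cmul coord_adj_op sum_distrib_left Re_sum)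
      also have "\<dots> = cmul c (basis x) \<bullet> adj_op g"
        by (simp only: inner_cmul_cancel inner_commute[of "basis x"] inner_basis)
      finally show ?thesis .
    qed
  qed
  then show ?thesis by (simp add: symmetric_op_def)
qed

sublocale bounded_symmetric adj_op "real D + 1"
  by (rule bounded_symmetric.intro)
     (simp_all add: linear_adj_op symmetric_adj_op norm_adj_op_le)

lemma delta_in_ell2: "x \<in> verts G \<Longrightarrow> delta x \<in> ell2 (verts G)"
  unfolding basis.rep_eq[symmetric] coord_in_ell2_iff by (auto intro!: l2_eqI)

lemma Abs_l2_delta: "Abs_l2 (delta x) = basis x"
  by (metis basis.rep_eq coord_inverse)

lemma adjacency_operator_eq: "adjacency_operator G = restrict_op (verts G) adj_op"
  unfolding adjacency_operator_def
proof (rule the_equality)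
  interpret A: operator_on "verts G" adj_op
    by (rule operator_on.intro) (simp_all add: bounded_linear_adj_op adj_op_cmul restr_adj_op)
  show "bounded_operator (verts G) (restrict_op (verts G) adj_op) \<and>
      (\<forall>x\<in>verts G. restrict_op (verts G) adj_op (delta x) = (\<lambda>y. \<Sum>x'\<in>neighbours G x. delta x' y))"
    by (auto simp: A.bounded_operator_restrict_op restrict_op_apply delta_in_ell2 Abs_l2_delta
        adj_op_basis basis.rep_eq)
next
  fix T
  assume T: "bounded_operator (verts G) T \<and>
      (\<forall>x\<in>verts G. T (delta x) = (\<lambda>y. \<Sum>x'\<in>neighbours G x. delta x' y))"
  then have b: "bounded_operator (verts G) T" by blast
  \<comment> \<open>For uniqueness, the zero extension of \<open>T\<close> is compared with
    \<open>adj_op\<close> on every basis vector; outside the vertex set both vanish.\<close>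
  have basis: "extend_op (verts G) T (basis x) = adj_op (basis x)" for x
  proof (cases "x \<in> verts G")
    case True
    then have "restr (verts G) (basis x) = basis x" by (auto intro!: l2_eqI)
    then show ?thesis
      using T True
      by (intro l2_eqI) (simp add: coord_extend_op[OF b] adj_op_basis basis.rep_eq)
  next
    case False
    then have 0: "restr (verts G) (basis x) = 0" by (auto intro!: l2_eqI)
    have "extend_op (verts G) T (basis x) = extend_op (verts G) T 0"
      by (simp add: extend_op_restr[OF b, symmetric, of "basis x"] 0)
    also have "\<dots> = adj_op (basis x)"
      using adj_op_restr[of "basis x"]
      by (simp add: 0 linear_0[OF linear_adj_op] linear_0[OF bounded_linear.linear[OF bounded_linear_extend_op[OF b]]])
    finally show ?thesis .
  qed
  have "extend_op (verts G) T f = adj_op f" for f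
    by (rule bounded_linear_eq_on_basis[OF bounded_linear_extend_op[OF b] bounded_linear_adj_op])
       (simp add: extend_op_cmul[OF b] adj_op_cmul basis)
  then show "T = restrict_op (verts G) adj_op"
    using restrict_extend_op[OF b] by (metis ext)
qed

lemma energy_eq:
  assumes v: "v \<in> verts G"
  shows "energy G v = complex_of_real (modulus (basis v) \<bullet> basis v)"
proof -
  note abs = abs_operator_restrict_op[OF bounded_symmetric_axioms adj_op_cmul restr_adj_op adj_op_restr]
  interpret M: operator_on "verts G" modulus by (rule abs(2))
  show ?thesis
    unfolding energy_def adjacency_operator_eq abs(1)
    by (simp add: M.l2_inner_restrict_op_left delta_in_ell2[OF v] Abs_l2_delta abs(3) complex_eq_iff)
qed

section \<open>Walks, balls and local determination of moments\<close>

text \<open>Without walks the infimum is the top element, which exceeds \<open>d\<close>; otherwise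
  it is attained, because \<open>enat\<close> is well-ordered.\<close>

lemma graph_dist_le_iff: "graph_dist G x y \<le> enat d \<longleftrightarrow> (\<exists>k\<le>d. (adj G ^^ k) x y)"
proof
  assume le: "graph_dist G x y \<le> enat d"
  let ?S = "enat ` {k. (adj G ^^ k) x y}"
  have "?S \<noteq> {}"
  proof
    assume S: "?S = {}"
    show False using le unfolding graph_dist_def S by (simp add: top_enat_def)
  qed
  then have "Inf ?S \<in> ?S" by (auto intro: wellorder_InfI)
  then show "\<exists>k\<le>d. (adj G ^^ k) x y" using le by (auto simp: graph_dist_def)
next
  assume "\<exists>k\<le>d. (adj G ^^ k) x y"
  then obtain k where "k \<le> d" "(adj G ^^ k) x y" by blast
  then show "graph_dist G x y \<le> enat d"
    unfolding graph_dist_def by (intro INF_lower2[of k]) auto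
qed

lemma walk_verts: "v \<in> verts G \<Longrightarrow> (adj G ^^ k) v x \<Longrightarrow> x \<in> verts G"
  by (cases k) (use adj_verts in \<open>auto elim!: relcomppE\<close>)

lemma walk_in_ball:
  "v \<in> verts G \<Longrightarrow> (adj G ^^ k) v x \<Longrightarrow> k \<le> d \<Longrightarrow> x \<in> verts (graph_ball G v d)"
  by (auto simp: graph_ball_def induced_subgraph_def graph_dist_le_iff walk_verts)

lemma adj_ball_iff:
  "adj (graph_ball G v d) x y \<longleftrightarrow>
    adj G x y \<and> x \<in> verts (graph_ball G v d) \<and> y \<in> verts (graph_ball G v d)"
  by (auto simp: graph_ball_def induced_subgraph_def adj_def)

end

text \<open>Each application of the operator looks one step farther from the root. In the induction
  \<open>k\<close> drops while \<open>j\<close> rises, so \<open>k + j \<le> d\<close> keeps all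
  neighbourhoods consulted inside the ball, where \<open>\<phi>\<close> preserves them.\<close>

lemma ball_iso_powers_eq:
  assumes "bounded_degree_graph G D" "bounded_degree_graph H E"
    and v: "v \<in> verts G" and w: "w \<in> verts H"
    and iso: "graph_iso \<phi> (graph_ball G v d) (graph_ball H w d)" and \<phi>v: "\<phi> v = w"
    and walk: "(adj G ^^ j) v x" and le: "k + j \<le> d"
  shows "coord ((bounded_degree_graph.adj_op G ^^ k) (basis v)) x =
    coord ((bounded_degree_graph.adj_op H ^^ k) (basis w)) (\<phi> x)"
proof -
  interpret G: bounded_degree_graph G D by fact
  interpret H: bounded_degree_graph H E by fact
  let ?B = "verts (graph_ball G v d)" and ?C = "verts (graph_ball H w d)"
  have inj: "inj_on \<phi> ?B" and surj: "\<phi> ` ?B = ?C"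
    using iso by (auto simp: graph_iso_def bij_betw_def)
  have adj: "adj H (\<phi> x) (\<phi> y) \<longleftrightarrow> adj G x y" if "x \<in> ?B" "y \<in> ?B" for x y
  proof -
    have "\<phi> x \<in> ?C" "\<phi> y \<in> ?C" using that surj by auto
    then show ?thesis
      using iso that by (auto simp: graph_iso_def G.adj_ball_iff H.adj_ball_iff)
  qed
  \<comment> \<open>A walk of length at most \<open>d\<close> from the root never leaves the ball,
    so the isomorphism carries it over edge by edge.\<close>
  have walk_image: "(adj H ^^ j) w (\<phi> x)" if "(adj G ^^ j) v x" "j \<le> d" for j x
    using that
  proof (induction j arbitrary: x)
    case 0
    then show ?case using \<phi>v by simp
  next
    case (Suc j)
    obtain y where y: "(adj G ^^ j) v y" "adj G y x"
      using Suc.prems(1) by (rule relpowp_Suc_E)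
    have "y \<in> ?B" "x \<in> ?B"
      using G.walk_in_ball[OF v y(1)] G.walk_in_ball[OF v Suc.prems(1)] Suc.prems(2) by auto
    then have "adj H (\<phi> y) (\<phi> x)" using y(2) by (simp add: adj)
    then show ?case
      using Suc.IH[OF y(1)] Suc.prems(2) by (intro relpowp_Suc_I) auto
  qed
  show ?thesis using walk le
  proof (induction k arbitrary: j x)
    case 0
    have "x \<in> ?B" "v \<in> ?B"
      using G.walk_in_ball[OF v 0(1)] G.walk_in_ball[OF v, of 0 v] 0(2) by auto
    then have "x = v \<longleftrightarrow> \<phi> x = w" using inj \<phi>v by (auto dest: inj_onD)
    then show ?case by simp
  next
    case (Suc k)
    have nb: "y \<in> ?B \<and> (adj G ^^ Suc j) v y" if "y \<in> neighbours G x" for y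
    proof -
      have "(adj G ^^ Suc j) v y"
        using Suc.prems(1) that by (intro relpowp_Suc_I) (auto simp: neighbours_def)
      then show ?thesis using G.walk_in_ball[OF v, of "Suc j" y d] Suc.prems(2) by auto
    qed
    have x: "x \<in> ?B" using G.walk_in_ball[OF v Suc.prems(1)] Suc.prems(2) by simp
    have "bij_betw \<phi> (neighbours G x) (neighbours H (\<phi> x))"
      unfolding bij_betw_def
    proof
      show "inj_on \<phi> (neighbours G x)" using inj nb by (meson inj_on_subset subsetI)
      show "\<phi> ` neighbours G x = neighbours H (\<phi> x)"
      proof (intro equalityI subsetI)
        fix z assume "z \<in> \<phi> ` neighbours G x"
        then show "z \<in> neighbours H (\<phi> x)" using nb x adj by (auto simp: neighbours_def)
      next
        fix z assume z: "z \<in> neighbours H (\<phi> x)"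
        \<comment> \<open>A neighbour of \<open>\<phi> x\<close> is reached from \<open>w\<close> in
          \<open>Suc j \<le> d\<close> steps. It therefore lies in the ball, and surjectivity of
          \<open>\<phi>\<close> supplies a preimage.\<close>
        have "(adj H ^^ j) w (\<phi> x)" using walk_image Suc.prems by simp
        then have "(adj H ^^ Suc j) w z"
          using z by (intro relpowp_Suc_I) (auto simp: neighbours_def)
        then have "z \<in> ?C" using H.walk_in_ball[OF w, of "Suc j" z d] Suc.prems(2) by simp
        then obtain y where "y \<in> ?B" "z = \<phi> y" using surj by blast
        then show "z \<in> \<phi> ` neighbours G x" using z x adj by (auto simp: neighbours_def)
      qed
    qed
    moreover have "coord ((G.adj_op ^^ k) (basis v)) y = coord ((H.adj_op ^^ k) (basis w)) (\<phi> y)"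
      if "y \<in> neighbours G x" for y
      using Suc.IH[of "Suc j" y] nb[OF that] Suc.prems(2) by simp
    ultimately show ?case
      by (simp add: G.coord_adj_op H.coord_adj_op sum.reindex_bij_betw cong: sum.cong)
  qed
qed

section \<open>Convergence of the energies\<close>

lemma bounded_degree_graphI:
  assumes "simple_graph G" "uniformly_locally_finite G"
  shows "\<exists>D. bounded_degree_graph G D"
  using assms by (auto simp: uniformly_locally_finite_def intro!: bounded_degree_graph.intro)

theorem theorem7p3:
  fixes G :: "nat \<Rightarrow> 'a ugraph" and v :: "nat \<Rightarrow> 'a"
    and H :: "'b ugraph" and w :: 'b
  assumes "\<And>n. n \<ge> 1 \<Longrightarrow> simple_graph (G n)"
    and "\<And>n. n \<ge> 1 \<Longrightarrow> uniformly_locally_finite (G n)"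
    and "\<And>n. n \<ge> 1 \<Longrightarrow> v n \<in> verts (G n)"
    and "simple_graph H"
    and "uniformly_locally_finite H"
    and "w \<in> verts H"
    and "\<And>d. \<exists>N\<ge>1. \<forall>n\<ge>N.
           rooted_isomorphic (graph_ball (G n) (v n) d) (v n) (graph_ball H w d) w"
  shows "(\<lambda>n. energy (G n) (v n)) \<longlonglongrightarrow> energy H w"
proof -
  obtain E where E: "bounded_degree_graph H E"
    using bounded_degree_graphI assms(4,5) by blast
  interpret H: bounded_degree_graph H E by (rule E)
  have "\<forall>n. \<exists>D. n \<ge> 1 \<longrightarrow> bounded_degree_graph (G n) D"
    using bounded_degree_graphI assms(1,2) by blast
  then obtain D where D: "\<And>n. n \<ge> 1 \<Longrightarrow> bounded_degree_graph (G n) (D n)"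
    by metis
  let ?A = "\<lambda>n. bounded_degree_graph.adj_op (G n)" and ?N = "\<lambda>n. real (D n) + 1"
  have ev1: "\<forall>\<^sub>F n in sequentially. n \<ge> 1" by (rule eventually_ge_at_top)
  have sym: "\<forall>\<^sub>F n in sequentially. bounded_symmetric (?A n) (?N n)"
    using ev1
  proof eventually_elim
    case (elim n)
    interpret G: bounded_degree_graph "G n" "D n" by (rule D[OF elim])
    show ?case by (rule G.bounded_symmetric_axioms)
  qed
  \<comment> \<open>The \<open>k\<close>-th moment is the real part of the root coordinate after
    \<open>k\<close> applications, so the ball of radius \<open>k\<close> determines it, by the case
    \<open>j = 0\<close> at the root.\<close>
  have mom: "\<forall>\<^sub>F n in sequentially.
      (?A n ^^ k) (basis (v n)) \<bullet> basis (v n) = (H.adj_op ^^ k) (basis w) \<bullet> basis w" for k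
  proof -
    obtain N where N: "N \<ge> 1" "\<And>n. n \<ge> N \<Longrightarrow>
        rooted_isomorphic (graph_ball (G n) (v n) k) (v n) (graph_ball H w k) w"
      using assms(7) by blast
    have "(?A n ^^ k) (basis (v n)) \<bullet> basis (v n) = (H.adj_op ^^ k) (basis w) \<bullet> basis w"
      if n: "n \<ge> N" for n
    proof -
      have n1: "n \<ge> 1" using n N(1) by simp
      obtain \<phi> where \<phi>: "graph_iso \<phi> (graph_ball (G n) (v n) k) (graph_ball H w k)" "\<phi> (v n) = w"
        using N(2)[OF n] by (auto simp: rooted_isomorphic_def)
      have "(adj (G n) ^^ 0) (v n) (v n)" by simp
      from ball_iso_powers_eq[OF D[OF n1] E assms(3)[OF n1] assms(6) \<phi> this, of k]
      show ?thesis by (simp add: inner_basis \<phi>(2))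
    qed
    then show ?thesis by (auto simp: eventually_sequentially)
  qed
  have "(\<lambda>n. bounded_symmetric.modulus (?A n) (?N n) (basis (v n)) \<bullet> basis (v n))
      \<longlonglongrightarrow> H.modulus (basis w) \<bullet> basis w"
    by (rule modulus_moment_continuity[OF sym H.bounded_symmetric_axioms _ _ mom])
       (simp_all add: norm_basis)
  then have "(\<lambda>n. complex_of_real (bounded_symmetric.modulus (?A n) (?N n) (basis (v n)) \<bullet> basis (v n)))
      \<longlonglongrightarrow> energy H w"
    unfolding H.energy_eq[OF assms(6)] by (rule tendsto_of_real)
  \<comment> \<open>The identification with the energy is available from index 1 on, hence only
    eventually.\<close>
  moreover have "\<forall>\<^sub>F n in sequentially. complex_of_real
      (bounded_symmetric.modulus (?A n) (?N n) (basis (v n)) \<bullet> basis (v n)) = energy (G n) (v n)"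
    using ev1
  proof eventually_elim
    case (elim n)
    interpret G: bounded_degree_graph "G n" "D n" by (rule D[OF elim])
    show ?case by (rule G.energy_eq[OF assms(3)[OF elim], symmetric])
  qed
  ultimately show ?thesis by (rule Lim_transform_eventually)
qed

end
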